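(* Let $\mathcal{D}$ be an arbitrary o-minimal structure on $(\mathbf{R}, +, \cdot)$, let $f : \mathbf{R}^n \to \mathbf{R}$ be a smooth function definable in $\mathcal{D}$, and for $R > 0$ let $\mathbf{S}_R := \{ x \in \mathbf{R}^n \mid \|x\| = R \}$. Then the cardinality of $\Sigma_f$ is less than or equal to the number of connected components of $\{x \in \mathbf{R}^n \mid \operatorname{grad} f(x) = 0\}$, and, for every sufficiently large $R > 0$ (i.e. there is $R_0 > 0$ such that for all $R \geq R_0$), the cardinality of $S_f$ is less than or equal to the number of connected components of the intersection $M(f) \cap \mathbf{S}_R$.
   Context: Smooth means $C^\infty$, and $\|\cdot\|$ is the Euclidean norm. An o-minimal structure on the real field $(\mathbf{R}, +, \cdot)$ is a family $\mathcal{D} = (\mathcal{D}_n)_{n \in \mathbf{N}}$ such that for each $n \in \mathbf{N}$: - (D1) $\mathcal{D}_n$ is a boolean algebra of subsets of $\mathbf{R}^n$ (closed under complements and finite unions). - (D2) If $A \in \mathcal{D}_n$, then $A \times \mathbf{R} \in \mathcal{D}_{n+1}$ and $\mathbf{R} \times A \in \mathcal{D}_{n+1}$. - (D3) If $A \in \mathcal{D}_{n+1}$, then $\pi(A) \in \mathcal{D}_n$, where $\pi : \mathbf{R}^{n+1} \to \mathbf{R}^n$ is the projection on the first $n$ coordinates. - (D4) $\mathcal{D}_n$ contains $\{x \in \mathbf{R}^n \mid P(x) = 0\}$ for every polynomial $P \in \mathbf{R}[X_1, \ldots, X_n]$. - (D5) Each set belonging to $\mathcal{D}_1$ is a finite union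 of intervals (possibly unbounded) and points. A set $A \subseteq \mathbf{R}^n$ is definable (in $\mathcal{D}$) if $A \in \mathcal{D}_n$; a map is definable if its graph is a definable set. For a smooth function $f : \mathbf{R}^n \to \mathbf{R}$: - $\Sigma_f$ is the set of critical values of $f$, i.e. $\Sigma_f = \{ f(x) \mid x \in \mathbf{R}^n, \operatorname{grad} f(x) = 0 \}$. - $M(f) := \{ x \in \mathbf{R}^n \mid \exists \lambda \in \mathbf{R},\ \operatorname{grad} f(x) = \lambda x \}$. - $S_f$ is the set of all $c \in \mathbf{R}$ for which there exists a sequence $\{y^k\} \subseteq M(f)$ with $\lim_{k\to\infty} \|y^k\| = \infty$ and $\lim_{k \to \infty} f(y^k) = c$. *)

theory Defs
  imports "HOL-Analysis.Analysis" "HOL-Library.Poly_Mapping" "HOL-Library.Equipollence"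
begin

section \<open>O-minimal structures on the real field\<close>

text \<open>
  An o-minimal structure is a family indexed by the dimension, so a point of $\mathbf{R}^n$
  is represented here by a real list of length \<open>n\<close>.
\<close>

definition Rn :: "nat \<Rightarrow> real list set" where
  "Rn n = {xs. length xs = n}"

text \<open>
  A polynomial in \<open>X\<^sub>0, X\<^sub>1, \<dots>\<close> is a finitely supported map from monomials to coefficients,
  a monomial being a finitely supported map from variable indices to exponents.
\<close>

type_synonym real_mpoly = "(nat \<Rightarrow>\<^sub>0 nat) \<Rightarrow>\<^sub>0 real"

definition mpoly_in_vars :: "nat \<Rightarrow> real_mpoly \<Rightarrow> bool" where
  "mpoly_in_vars n P \<longleftrightarrow> (\<forall>m\<in>Poly_Mapping.keys P. Poly_Mapping.keys m \<subseteq> {..<n})"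

definition mpoly_eval :: "real_mpoly \<Rightarrow> real list \<Rightarrow> real" where
  "mpoly_eval P xs =
     (\<Sum>m\<in>Poly_Mapping.keys P. Poly_Mapping.lookup P m *
        (\<Prod>i\<in>Poly_Mapping.keys m. (xs ! i) ^ Poly_Mapping.lookup m i))"

text \<open>
  In the last axiom \<^const>\<open>is_interval\<close> means order-convex: it covers bounded and unbounded
  intervals with any kind of endpoints, as well as single points.
\<close>

locale o_minimal_structure =
  fixes D :: "nat \<Rightarrow> real list set set"
  assumes boolean_algebra: "\<And>n. algebra (Rn n) (D n)"
    and times_line: "\<And>n A. A \<in> D n \<Longrightarrow> {xs @ [t] | xs t. xs \<in> A} \<in> D (Suc n)"
    and line_times: "\<And>n A. A \<in> D n \<Longrightarrow> {t # xs | t xs. xs \<in> A} \<in> D (Suc n)"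
    and projection: "\<And>n A. A \<in> D (Suc n) \<Longrightarrow> take n ` A \<in> D n"
    and algebraic: "\<And>n P. mpoly_in_vars n P \<Longrightarrow> {xs \<in> Rn n. mpoly_eval P xs = 0} \<in> D n"
    and o_minimal: "\<And>A. A \<in> D 1 \<Longrightarrow>
      \<exists>\<I>. finite \<I> \<and> (\<forall>I\<in>\<I>. is_interval I) \<and> {t. [t] \<in> A} = \<Union>\<I>"

text \<open>
  Bridge to the Euclidean space \<^typ>\<open>real ^ 'n\<close>: an enumeration \<open>e\<close> of the index type, that is
  a bijection from \<open>{..<CARD('n)}\<close>, identifies it with \<open>Rn CARD('n)\<close>.
\<close>

definition coords :: "(nat \<Rightarrow> 'n) \<Rightarrow> real ^ 'n \<Rightarrow> real list" where
  "coords e x = map (\<lambda>i. x $ e i) [0..<CARD('n)]"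

definition definable_fun ::
    "(nat \<Rightarrow> real list set set) \<Rightarrow> (nat \<Rightarrow> 'n) \<Rightarrow> (real ^ 'n \<Rightarrow> real) \<Rightarrow> bool" where
  "definable_fun D e f \<longleftrightarrow> range (\<lambda>x. coords e x @ [f x]) \<in> D (Suc CARD('n))"

section \<open>Smooth functions\<close>

text \<open>\<open>C_diff k f\<close>: \<open>f\<close> is of class $C^k$ on the whole space.\<close>

fun C_diff :: "nat \<Rightarrow> ('a::euclidean_space \<Rightarrow> real) \<Rightarrow> bool" where
  "C_diff 0 f \<longleftrightarrow> continuous_on UNIV f"
| "C_diff (Suc k) f \<longleftrightarrow>
     (\<forall>x. f differentiable (at x)) \<and> (\<forall>v. C_diff k (\<lambda>x. frechet_derivative f (at x) v))"

definition smooth :: "('a::euclidean_space \<Rightarrow> real) \<Rightarrow> bool" where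
  "smooth f \<longleftrightarrow> (\<forall>k. C_diff k f)"

text \<open>Only meaningful where \<open>f\<close> is differentiable.\<close>

definition grad :: "('a::euclidean_space \<Rightarrow> real) \<Rightarrow> 'a \<Rightarrow> 'a" where
  "grad f x = (THE D. GDERIV f x :> D)"

section \<open>Critical values and asymptotic critical values\<close>

definition crit_values :: "('a::euclidean_space \<Rightarrow> real) \<Rightarrow> real set" where
  "crit_values f = {f x | x. grad f x = 0}"

definition M_set :: "('a::euclidean_space \<Rightarrow> real) \<Rightarrow> 'a set" where
  "M_set f = {x. \<exists>\<mu>::real. grad f x = \<mu> *\<^sub>R x}"

definition S_set :: "('a::euclidean_space \<Rightarrow> real) \<Rightarrow> real set" where
  "S_set f = {c. \<exists>y :: nat \<Rightarrow> 'a. (\<forall>k. y k \<in> M_set f) \<and>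
            filterlim (\<lambda>k. norm (y k)) at_top sequentially \<and> (\<lambda>k. f (y k)) \<longlonglongrightarrow> c}"

end

theory Submission
  imports Defs
begin

text \<open>
  Two facts have to be shown: \<open>f\<close> takes only finitely many values on its critical set and on
  each \<open>M_set f \<inter> sphere 0 R\<close> with \<open>R > 0\<close>, and \<open>S_set f\<close> is finite. A continuous function with finitely many
  values is constant on connected sets, so every component carries a single value. For the critical
  set this is the claim. For \<open>S_set f\<close>, let \<open>\<delta> > 0\<close> be a lower bound for the distances between its
  elements. Given \<open>c \<in> S_set f\<close>, the set of radii \<open>R\<close> for which \<open>M_set f \<inter> sphere 0 R\<close> has a point with value
  within \<open>\<delta> / 2\<close> of \<open>c\<close> is definable and unbounded, so it contains a half-line. Thus for all large
  \<open>R\<close> every \<open>c\<close> is approximated on the sphere of radius \<open>R\<close>, and different \<open>c\<close> lead to different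
  values, hence to different components.

  O-minimality is used through a Baire-type principle (\<open>definable_countable_cover\<close>): if an open
  interval is covered by countably many definable sets, then one of them contains an open interval,
  because otherwise all of them would meet the interval in finite sets. This turns pointwise
  thresholds into thresholds that are uniform on a subinterval, and replaces the monotonicity
  theorem, definable choice and cell decomposition.

  The finiteness of the values on the critical sets is a form of Sard's theorem
  (\<open>finite_image_if_quadratically_flat\<close>). If the image of \<open>C\<close> is infinite, it contains an interval,
  and over a subinterval there is a section \<open>g\<close> of \<open>f\<close> with values in \<open>C\<close> and weakly monotone
  coordinates (\<open>monotone_selection\<close>). Both kinds of critical sets are flat for \<open>f\<close>:
  \<open>\<bar>f x - f y\<bar> \<le> L * (norm (x - y))\<^sup>2\<close> locally. So the increments of \<open>g\<close> over \<open>N\<close> equal steps are at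
  least of order \<open>1 / sqrt N\<close>, and their sum grows like \<open>sqrt N\<close>. It is however bounded by the
  total variation of the monotone coordinates.

  The finiteness of \<open>S_set f\<close> (\<open>finite_asymptotic_values\<close>) follows from the same principle: if
  \<open>S_set f\<close> contained an interval, then on a subinterval either all values would be taken on one
  sphere, which has only finitely many, or none would be taken on any large sphere.

  Definability of all the sets involved is obtained from closure under first-order logic
  (\<open>definable_pred\<close>, \<open>definable_term\<close>).
\<close>

section \<open>Evaluating polynomials\<close>

definition monom_eval :: "(nat \<Rightarrow>\<^sub>0 nat) \<Rightarrow> real list \<Rightarrow> real" where
  "monom_eval m xs = (\<Prod>i\<in>Poly_Mapping.keys m. (xs ! i) ^ Poly_Mapping.lookup m i)"

lemma monom_eval_superset:
  assumes "finite I" "Poly_Mapping.keys m \<subseteq> I"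
  shows "monom_eval m xs = (\<Prod>i\<in>I. (xs ! i) ^ Poly_Mapping.lookup m i)"
  unfolding monom_eval_def
  by (rule prod.mono_neutral_left) (use assms in \<open>auto simp: in_keys_iff\<close>)

lemma monom_eval_add: "monom_eval (m + m') xs = monom_eval m xs * monom_eval m' xs"
proof -
  let ?I = "Poly_Mapping.keys m \<union> Poly_Mapping.keys m'"
  have "monom_eval (m + m') xs = (\<Prod>i\<in>?I. (xs ! i) ^ Poly_Mapping.lookup (m + m') i)"
    by (rule monom_eval_superset) (auto intro!: Poly_Mapping.keys_add)
  then show ?thesis
    by (simp add: monom_eval_superset[of ?I m] monom_eval_superset[of ?I m']
        lookup_add power_add prod.distrib)
qed

lemma monom_eval_var: "monom_eval (Poly_Mapping.single i (Suc 0)) xs = xs ! i"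
  by (simp add: monom_eval_def)

lemma mpoly_eval_superset:
  assumes "finite I" "Poly_Mapping.keys P \<subseteq> I"
  shows "mpoly_eval P xs = (\<Sum>m\<in>I. Poly_Mapping.lookup P m * monom_eval m xs)"
  unfolding mpoly_eval_def monom_eval_def[symmetric]
  by (rule sum.mono_neutral_left) (use assms in \<open>auto simp: in_keys_iff\<close>)

lemma mpoly_eval_add: "mpoly_eval (P + Q) xs = mpoly_eval P xs + mpoly_eval Q xs"
proof -
  let ?I = "Poly_Mapping.keys P \<union> Poly_Mapping.keys Q"
  have "mpoly_eval (P + Q) xs = (\<Sum>m\<in>?I. Poly_Mapping.lookup (P + Q) m * monom_eval m xs)"
    by (rule mpoly_eval_superset) (auto intro!: Poly_Mapping.keys_add)
  then show ?thesis
    by (simp add: mpoly_eval_superset[of ?I P] mpoly_eval_superset[of ?I Q]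
        lookup_add distrib_right sum.distrib)
qed

lemma mpoly_eval_single: "mpoly_eval (Poly_Mapping.single m c) xs = c * monom_eval m xs"
  by (simp add: mpoly_eval_def monom_eval_def)

lemma mpoly_in_vars_add:
  "mpoly_in_vars n P \<Longrightarrow> mpoly_in_vars n Q \<Longrightarrow> mpoly_in_vars n (P + Q)"
  unfolding mpoly_in_vars_def using Poly_Mapping.keys_add[of P Q] by blast

lemma mpoly_in_vars_single:
  "Poly_Mapping.keys m \<subseteq> {..<n} \<Longrightarrow> mpoly_in_vars n (Poly_Mapping.single m c)"
  unfolding mpoly_in_vars_def by auto

section \<open>First-order definability\<close>

context o_minimal_structure
begin

lemma D_subset: "A \<in> D n \<Longrightarrow> A \<subseteq> Rn n"
  using boolean_algebra[of n] by (auto simp: algebra_iff_Un)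

lemma D_length: "A \<in> D n \<Longrightarrow> xs \<in> A \<Longrightarrow> length xs = n"
  using D_subset by (auto simp: Rn_def)

lemma D_Int: "A \<in> D n \<Longrightarrow> B \<in> D n \<Longrightarrow> A \<inter> B \<in> D n"
  using boolean_algebra[of n] by (auto simp: algebra_iff_Int)

lemma D_compl: "A \<in> D n \<Longrightarrow> Rn n - A \<in> D n"
  using boolean_algebra[of n] by (auto simp: algebra_iff_Un)

lemma D_top: "Rn n \<in> D n"
  using boolean_algebra[of n] D_compl[of "{}" n] by (auto simp: algebra_iff_Un)

lemma D_eq_vars:
  assumes "i < n" "j < n"
  shows "{xs \<in> Rn n. xs ! i = xs ! j} \<in> D n"
proof -
  let ?P = "Poly_Mapping.single (Poly_Mapping.single i 1) 1
    + Poly_Mapping.single (Poly_Mapping.single j 1) (-1) :: real_mpoly"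
  have "mpoly_in_vars n ?P"
    using assms by (intro mpoly_in_vars_add mpoly_in_vars_single) auto
  from algebraic[OF this] show ?thesis
    by (simp add: mpoly_eval_add mpoly_eval_single monom_eval_var)
qed

lemma D_eq_const:
  assumes "i < n"
  shows "{xs \<in> Rn n. xs ! i = c} \<in> D n"
proof -
  let ?P = "Poly_Mapping.single (Poly_Mapping.single i 1) 1
    + Poly_Mapping.single 0 (-c) :: real_mpoly"
  have "mpoly_in_vars n ?P"
    using assms by (intro mpoly_in_vars_add mpoly_in_vars_single) auto
  from algebraic[OF this] show ?thesis
    by (simp add: mpoly_eval_add mpoly_eval_single monom_eval_var monom_eval_def)
qed

lemma D_eq_add:
  assumes "i < n" "j < n" "k < n"
  shows "{xs \<in> Rn n. xs ! i = xs ! j + xs ! k} \<in> D n"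
proof -
  let ?P = "Poly_Mapping.single (Poly_Mapping.single i 1) 1
    + (Poly_Mapping.single (Poly_Mapping.single j 1) (-1)
    + Poly_Mapping.single (Poly_Mapping.single k 1) (-1)) :: real_mpoly"
  have "mpoly_in_vars n ?P"
    using assms by (intro mpoly_in_vars_add mpoly_in_vars_single) auto
  from algebraic[OF this] show ?thesis
    by (simp add: mpoly_eval_add mpoly_eval_single monom_eval_var algebra_simps)
qed

lemma D_eq_mult:
  assumes "i < n" "j < n" "k < n"
  shows "{xs \<in> Rn n. xs ! i = xs ! j * xs ! k} \<in> D n"
proof -
  let ?P = "Poly_Mapping.single (Poly_Mapping.single i 1) 1
    + Poly_Mapping.single (Poly_Mapping.single j 1 + Poly_Mapping.single k 1) (-1) :: real_mpoly"
  have "mpoly_in_vars n ?P"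
    using assms keys_add[of "Poly_Mapping.single j (1::nat)" "Poly_Mapping.single k 1"]
    by (intro mpoly_in_vars_add mpoly_in_vars_single) auto
  from algebraic[OF this] show ?thesis
    by (simp add: mpoly_eval_add mpoly_eval_single monom_eval_var monom_eval_add algebra_simps)
qed

lemma D_raise:
  assumes "A \<in> D n"
  shows "{xs \<in> Rn (n + k). take n xs \<in> A} \<in> D (n + k)"
proof (induction k)
  case 0
  have "{xs \<in> Rn (n + 0). take n xs \<in> A} = A"
    using D_subset[OF assms] by (auto simp: Rn_def)
  then show ?case using assms by simp
next
  case (Suc k)
  let ?B = "{xs \<in> Rn (n + k). take n xs \<in> A}"
  have "{xs @ [t] | xs t. xs \<in> ?B} = {xs \<in> Rn (n + Suc k). take n xs \<in> A}" (is "?L = ?R")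
  proof (intro equalityI subsetI)
    fix zs assume "zs \<in> ?R"
    then have len: "length zs = Suc (n + k)" and "take n zs \<in> A" by (auto simp: Rn_def)
    then have "zs = butlast zs @ [last zs]" "butlast zs \<in> ?B"
      by (auto simp: Rn_def take_butlast intro!: append_butlast_last_id[symmetric])
    then show "zs \<in> ?L" by blast
  qed (auto simp: Rn_def)
  with times_line[OF Suc] show ?case by simp
qed

lemma D_prefix:
  assumes "A \<in> D n"
  shows "{xs \<in> Rn (k + n). drop k xs \<in> A} \<in> D (k + n)"
proof (induction k)
  case 0
  have "{xs \<in> Rn (0 + n). drop 0 xs \<in> A} = A"
    using D_subset[OF assms] by auto
  then show ?case using assms by simp
next
  case (Suc k)
  let ?B = "{xs \<in> Rn (k + n). drop k xs \<in> A}"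
  have "{t # xs | t xs. xs \<in> ?B} = {xs \<in> Rn (Suc k + n). drop (Suc k) xs \<in> A}"
    by (auto simp: Rn_def length_Suc_conv)
  with line_times[OF Suc] show ?case by simp
qed

lemma D_project:
  assumes "A \<in> D (n + k)"
  shows "take n ` A \<in> D n"
  using assms
proof (induction k arbitrary: A)
  case 0
  then have "take n ` A = A" using D_length[OF 0] by force
  with 0 show ?case by simp
next
  case (Suc k)
  have "take n ` take (n + k) ` A = take n ` A"
    by (simp add: image_image min_def)
  with Suc.IH[of "take (n + k) ` A"] projection[of A "n + k"] Suc.prems show ?case by simp
qed

lemma D_finite_INT:
  assumes "finite J" "\<And>j. j \<in> J \<Longrightarrow> {xs \<in> Rn n. P j xs} \<in> D n"
  shows "{xs \<in> Rn n. \<forall>j\<in>J. P j xs} \<in> D n"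
  using assms
proof (induction J rule: finite_induct)
  case empty
  then show ?case using D_top by simp
next
  case (insert j J)
  have "{xs \<in> Rn n. \<forall>i\<in>insert j J. P i xs}
      = {xs \<in> Rn n. P j xs} \<inter> {xs \<in> Rn n. \<forall>i\<in>J. P i xs}" by auto
  with insert show ?case by (auto intro!: D_Int)
qed

text \<open>
  Renaming variables and quantifying over an arbitrary variable are both instances of one
  construction: form the product of the ambient space with \<open>A\<close>, identify some coordinates of the
  two factors, and project to the first factor.
\<close>

lemma D_partial_pullback:
  assumes A: "A \<in> D n" and J: "J \<subseteq> {..<n}" and \<sigma>: "\<And>j. j \<in> J \<Longrightarrow> \<sigma> j < N"
  shows "{ys \<in> Rn N. \<exists>zs\<in>A. \<forall>j\<in>J. zs ! j = ys ! \<sigma> j} \<in> D N"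
proof -
  let ?E = "{ws \<in> Rn (N + n). drop N ws \<in> A} \<inter> {ws \<in> Rn (N + n). \<forall>j\<in>J. ws ! (N + j) = ws ! \<sigma> j}"
  have "?E \<in> D (N + n)"
  proof (intro D_Int D_prefix A D_finite_INT D_eq_vars)
    show "finite J" using J finite_subset by blast
  qed (use J \<sigma> in \<open>auto intro: trans_less_add1\<close>)
  then have "take N ` ?E \<in> D N" by (rule D_project)
  moreover have "take N ` ?E = {ys \<in> Rn N. \<exists>zs\<in>A. \<forall>j\<in>J. zs ! j = ys ! \<sigma> j}" (is "?L = ?R")
  proof (intro equalityI subsetI)
    fix ys assume "ys \<in> ?L"
    then obtain ws where ws: "ys = take N ws" "length ws = N + n" "drop N ws \<in> A"
      "\<forall>j\<in>J. ws ! (N + j) = ws ! \<sigma> j" by (auto simp: Rn_def)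
    have "ys ! \<sigma> j = ws ! \<sigma> j" if "j \<in> J" for j
      using ws(1) \<sigma>[OF that] by simp
    with ws show "ys \<in> ?R" by (simp add: Rn_def) (rule bexI[of _ "drop N ws"], simp_all)
  next
    fix ys assume "ys \<in> ?R"
    then obtain zs where zs: "length ys = N" "zs \<in> A" "\<forall>j\<in>J. zs ! j = ys ! \<sigma> j"
      by (auto simp: Rn_def)
    moreover have "length zs = n" using D_length[OF A] zs by auto
    ultimately have "ys @ zs \<in> ?E" "take N (ys @ zs) = ys"
      using \<sigma> by (auto simp: Rn_def nth_append)
    then show "ys \<in> ?L" by (intro image_eqI[of _ _ "ys @ zs"]) simp_all
  qed
  ultimately show ?thesis by simp
qed

text \<open>
  First-order definability is expressed for predicates of a valuation \<open>\<rho> :: nat \<Rightarrow> real\<close> of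
  infinitely many variables, of which finitely many matter. This keeps all formulas in one type,
  whatever their number of free variables. Quantifiers follow the de Bruijn convention: under a
  quantifier the bound variable is variable \<open>0\<close> and the others move up by one, so no choice of fresh
  names is needed.
\<close>

definition definable_pred :: "((nat \<Rightarrow> real) \<Rightarrow> bool) \<Rightarrow> bool" where
  "definable_pred P \<longleftrightarrow> (\<exists>n. \<exists>A\<in>D n. \<forall>\<rho>. P \<rho> \<longleftrightarrow> map \<rho> [0..<n] \<in> A)"

definition definable_term :: "((nat \<Rightarrow> real) \<Rightarrow> real) \<Rightarrow> bool" where
  "definable_term g \<longleftrightarrow> definable_pred (\<lambda>\<rho>. \<rho> 0 = g (\<lambda>i. \<rho> (Suc i)))"

lemma definable_predI:
  assumes "A \<in> D n" "\<And>\<rho>. P \<rho> \<longleftrightarrow> map \<rho> [0..<n] \<in> A"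
  shows "definable_pred P"
  using assms unfolding definable_pred_def by blast

text \<open>
  Variables that do not occur may be added, so two predicates can be represented by sets of
  the same dimension.
\<close>

lemma definable_pred_level:
  assumes "definable_pred P"
  obtains N where "\<And>m. m \<ge> N \<Longrightarrow> \<exists>A\<in>D m. \<forall>\<rho>. P \<rho> \<longleftrightarrow> map \<rho> [0..<m] \<in> A"
proof -
  from assms obtain n A where A: "A \<in> D n" "\<And>\<rho>. P \<rho> \<longleftrightarrow> map \<rho> [0..<n] \<in> A"
    unfolding definable_pred_def by blast
  show ?thesis
  proof (rule that[of n])
    fix m assume "m \<ge> n"
    then obtain k where m: "m = n + k" using le_Suc_ex by blast
    show "\<exists>A\<in>D m. \<forall>\<rho>. P \<rho> \<longleftrightarrow> map \<rho> [0..<m] \<in> A"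
      using D_raise[OF A(1), of k] A(2) unfolding m
      by (intro bexI[of _ "{xs \<in> Rn (n + k). take n xs \<in> A}"]) (auto simp: Rn_def take_map)
  qed
qed

lemma definable_not:
  assumes "definable_pred P"
  shows "definable_pred (\<lambda>\<rho>. \<not> P \<rho>)"
proof -
  from assms obtain n A where "A \<in> D n" "\<And>\<rho>. P \<rho> \<longleftrightarrow> map \<rho> [0..<n] \<in> A"
    unfolding definable_pred_def by blast
  then show ?thesis
    by (intro definable_predI[of "Rn n - A" n]) (auto intro: D_compl, simp add: Rn_def)
qed

lemma definable_conj:
  assumes "definable_pred P" "definable_pred Q"
  shows "definable_pred (\<lambda>\<rho>. P \<rho> \<and> Q \<rho>)"
proof -
  obtain N where N: "\<And>m. m \<ge> N \<Longrightarrow> \<exists>A\<in>D m. \<forall>\<rho>. P \<rho> \<longleftrightarrow> map \<rho> [0..<m] \<in> A"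
    using definable_pred_level[OF assms(1)] by blast
  obtain N' where N': "\<And>m. m \<ge> N' \<Longrightarrow> \<exists>A\<in>D m. \<forall>\<rho>. Q \<rho> \<longleftrightarrow> map \<rho> [0..<m] \<in> A"
    using definable_pred_level[OF assms(2)] by blast
  obtain A where "A \<in> D (max N N')" "\<And>\<rho>. P \<rho> \<longleftrightarrow> map \<rho> [0..<max N N'] \<in> A"
    using N[of "max N N'"] by auto
  moreover obtain B where "B \<in> D (max N N')" "\<And>\<rho>. Q \<rho> \<longleftrightarrow> map \<rho> [0..<max N N'] \<in> B"
    using N'[of "max N N'"] by auto
  ultimately show ?thesis
    by (intro definable_predI[of "A \<inter> B" "max N N'"]) (auto intro: D_Int)
qed

lemma definable_disj:
  "definable_pred P \<Longrightarrow> definable_pred Q \<Longrightarrow> definable_pred (\<lambda>\<rho>. P \<rho> \<or> Q \<rho>)"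
  using definable_not[OF definable_conj[OF definable_not definable_not], of P Q] by simp

lemma definable_imp:
  "definable_pred P \<Longrightarrow> definable_pred Q \<Longrightarrow> definable_pred (\<lambda>\<rho>. P \<rho> \<longrightarrow> Q \<rho>)"
  unfolding imp_conv_disj by (intro definable_disj definable_not)

lemma definable_rename:
  assumes "definable_pred P"
  shows "definable_pred (\<lambda>\<rho>. P (\<lambda>i. \<rho> (\<sigma> i)))"
proof -
  from assms obtain n A where A: "A \<in> D n" "\<And>\<rho>. P \<rho> \<longleftrightarrow> map \<rho> [0..<n] \<in> A"
    unfolding definable_pred_def by blast
  define N where "N = Suc (Max (insert 0 (\<sigma> ` {..<n})))"
  have N: "\<sigma> j < N" if "j < n" for j
    unfolding N_def using that by (simp add: less_Suc_eq_le)
  show ?thesis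
  proof (rule definable_predI)
    show "{ys \<in> Rn N. \<exists>zs\<in>A. \<forall>j\<in>{..<n}. zs ! j = ys ! \<sigma> j} \<in> D N"
      by (rule D_partial_pullback[OF A(1)]) (use N in auto)
    have "map (\<lambda>i. \<rho> (\<sigma> i)) [0..<n] \<in> A
      \<longleftrightarrow> (\<exists>zs\<in>A. \<forall>j<n. zs ! j = map \<rho> [0..<N] ! \<sigma> j)" (is "?L \<longleftrightarrow> ?R") for \<rho>
    proof
      assume ?L
      then show ?R by (rule bexI[rotated]) (use N in auto)
    next
      assume ?R
      then obtain zs where zs: "zs \<in> A" "\<forall>j<n. zs ! j = map \<rho> [0..<N] ! \<sigma> j" by blast
      have "map (\<lambda>i. \<rho> (\<sigma> i)) [0..<n] = zs"
        by (rule nth_equalityI) (use zs N D_length[OF A(1) zs(1)] in auto)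
      with zs show ?L by simp
    qed
    then show "P (\<lambda>i. \<rho> (\<sigma> i))
      \<longleftrightarrow> map \<rho> [0..<N] \<in> {ys \<in> Rn N. \<exists>zs\<in>A. \<forall>j\<in>{..<n}. zs ! j = ys ! \<sigma> j}" for \<rho>
      by (simp add: A(2) Rn_def lessThan_def)
  qed
qed

lemma definable_ex:
  assumes "definable_pred (\<lambda>\<rho>. Q (\<lambda>i. \<rho> (Suc i)) (\<rho> 0))"
  shows "definable_pred (\<lambda>\<rho>. \<exists>t. Q \<rho> t)"
proof -
  obtain N where N: "\<And>m. m \<ge> N \<Longrightarrow>
      \<exists>A\<in>D m. \<forall>\<rho>. Q (\<lambda>i. \<rho> (Suc i)) (\<rho> 0) \<longleftrightarrow> map \<rho> [0..<m] \<in> A"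
    using definable_pred_level[OF assms] by blast
  obtain A where A: "A \<in> D (Suc N)"
      "\<And>\<rho>. Q (\<lambda>i. \<rho> (Suc i)) (\<rho> 0) \<longleftrightarrow> map \<rho> [0..<Suc N] \<in> A"
    using N[of "Suc N"] by auto
  show ?thesis
  proof (rule definable_predI)
    show "{ys \<in> Rn N. \<exists>zs\<in>A. \<forall>j\<in>{1..<Suc N}. zs ! j = ys ! (j - 1)} \<in> D N"
      by (rule D_partial_pullback[OF A(1)]) auto
    have "(\<exists>t. Q \<rho> t) \<longleftrightarrow> (\<exists>zs\<in>A. \<forall>j\<in>{1..<Suc N}. zs ! j = map \<rho> [0..<N] ! (j - 1))"
      (is "?L \<longleftrightarrow> ?R") for \<rho>
    proof
      assume ?L
      then obtain t where "Q \<rho> t" by blast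
      with A(2)[of "case_nat t \<rho>"] have "map (case_nat t \<rho>) [0..<Suc N] \<in> A" by simp
      then show ?R by (rule bexI[rotated]) (auto simp del: upt_Suc split: nat.split)
    next
      assume ?R
      then obtain zs where zs: "zs \<in> A"
        "\<forall>j\<in>{1..<Suc N}. zs ! j = map \<rho> [0..<N] ! (j - 1)" by blast
      have "map (case_nat (zs ! 0) \<rho>) [0..<Suc N] = zs"
        by (rule nth_equalityI)
          (use zs D_length[OF A(1) zs(1)] in \<open>auto simp del: upt_Suc split: nat.split\<close>)
      with zs A(2)[of "case_nat (zs ! 0) \<rho>"] show ?L by auto
    qed
    then show "(\<exists>t. Q \<rho> t) \<longleftrightarrow>
        map \<rho> [0..<N] \<in> {ys \<in> Rn N. \<exists>zs\<in>A. \<forall>j\<in>{1..<Suc N}. zs ! j = ys ! (j - 1)}" for \<rho>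
      by (simp add: Rn_def)
  qed
qed

lemma definable_all:
  assumes "definable_pred (\<lambda>\<rho>. Q (\<lambda>i. \<rho> (Suc i)) (\<rho> 0))"
  shows "definable_pred (\<lambda>\<rho>. \<forall>t. Q \<rho> t)"
  using definable_not[OF definable_ex[of "\<lambda>\<rho> t. \<not> Q \<rho> t"]] definable_not[OF assms] by simp

text \<open>
  Substituting a term for a variable is quantifying over a variable that equals the term.
\<close>

lemma definable_inst:
  assumes "definable_pred (\<lambda>\<rho>. Q (\<lambda>i. \<rho> (Suc i)) (\<rho> 0))" "definable_term g"
  shows "definable_pred (\<lambda>\<rho>. Q \<rho> (g \<rho>))"
proof -
  have "definable_pred (\<lambda>\<rho>. \<exists>t. t = g \<rho> \<and> Q \<rho> t)"
    using assms unfolding definable_term_def by (intro definable_ex definable_conj)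
  then show ?thesis by simp
qed

lemma definable_term_shift:
  assumes "definable_term g"
  shows "definable_term (\<lambda>\<rho>. g (\<lambda>i. \<rho> (Suc i)))"
  using definable_rename[OF assms[unfolded definable_term_def], of "\<lambda>i. if i = 0 then 0 else Suc i"]
  unfolding definable_term_def by simp

lemma definable_eq:
  assumes "definable_term g" "definable_term h"
  shows "definable_pred (\<lambda>\<rho>. g \<rho> = h \<rho>)"
  using definable_inst[of "\<lambda>\<rho> t. t = h \<rho>" g] assms unfolding definable_term_def by simp

lemma definable_var: "definable_term (\<lambda>\<rho>. \<rho> k)"
  unfolding definable_term_def
  by (rule definable_predI[OF D_eq_vars[of 0 "Suc (Suc k)" "Suc k"]])
    (auto simp: Rn_def simp del: upt_Suc)

lemma definable_const: "definable_term (\<lambda>\<rho>. c)"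
  unfolding definable_term_def
  by (rule definable_predI[OF D_eq_const[of 0 1 c]]) (auto simp: Rn_def)

lemma definable_binop:
  assumes op: "definable_pred (\<lambda>\<rho>. \<rho> 2 = op (\<rho> 1) (\<rho> 0))"
    and g: "definable_term g" and h: "definable_term h"
  shows "definable_term (\<lambda>\<rho>. op (g \<rho>) (h \<rho>))"
proof -
  have 1: "definable_pred (\<lambda>\<rho>. \<rho> (Suc 0) = op (\<rho> 0) (h (\<lambda>i. \<rho> (Suc (Suc i)))))"
    using definable_inst[of "\<lambda>\<rho> t. \<rho> (Suc 0) = op (\<rho> 0) t"]
      definable_term_shift[OF definable_term_shift[OF h]] op
    by (simp add: numeral_2_eq_2)
  show ?thesis
    unfolding definable_term_def
    using definable_inst[of "\<lambda>\<rho> t. \<rho> 0 = op t (h (\<lambda>i. \<rho> (Suc i)))"] 1 definable_term_shift[OF g]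
    by simp
qed

lemma definable_add:
  "definable_term g \<Longrightarrow> definable_term h \<Longrightarrow> definable_term (\<lambda>\<rho>. g \<rho> + h \<rho>)"
  by (rule definable_binop[of "(+)"], rule definable_predI[OF D_eq_add[of 2 3 1 0]])
    (simp_all add: Rn_def numeral_2_eq_2 del: upt_Suc)

lemma definable_mult:
  "definable_term g \<Longrightarrow> definable_term h \<Longrightarrow> definable_term (\<lambda>\<rho>. g \<rho> * h \<rho>)"
  by (rule definable_binop[of "(*)"], rule definable_predI[OF D_eq_mult[of 2 3 1 0]])
    (simp_all add: Rn_def numeral_2_eq_2 del: upt_Suc)

lemma definable_diff:
  "definable_term g \<Longrightarrow> definable_term h \<Longrightarrow> definable_term (\<lambda>\<rho>. g \<rho> - h \<rho>)"
  using definable_add[OF _ definable_mult[OF definable_const[of "-1"]], of g h] by simp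

lemma definable_sum:
  assumes "finite I" "\<And>i. definable_term (g i)"
  shows "definable_term (\<lambda>\<rho>. \<Sum>i\<in>I. g i \<rho>)"
  using assms(1) by (induction) (auto intro: definable_const definable_add assms(2))

lemma definable_if:
  "definable_term g \<Longrightarrow> definable_term h \<Longrightarrow> definable_term (\<lambda>\<rho>. if c then g \<rho> else h \<rho>)"
  by (cases c) auto

text \<open>
  The order is definable from the field operations, since non-negative reals are squares.
\<close>

lemma definable_le:
  assumes "definable_term g" "definable_term h"
  shows "definable_pred (\<lambda>\<rho>. g \<rho> \<le> h \<rho>)"
proof -
  have "definable_pred (\<lambda>\<rho>. \<exists>z. h \<rho> = g \<rho> + z * z)"
    by (intro definable_ex definable_eq definable_add definable_mult definable_term_shift assms
        definable_var)
  moreover have "(\<exists>z. b = a + z * z) \<longleftrightarrow> a \<le> b" for a b :: real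
  proof
    assume "a \<le> b"
    then show "\<exists>z. b = a + z * z" by (intro exI[of _ "sqrt (b - a)"]) simp
  qed auto
  ultimately show ?thesis by simp
qed

lemma definable_less:
  assumes "definable_term g" "definable_term h"
  shows "definable_pred (\<lambda>\<rho>. g \<rho> < h \<rho>)"
  using definable_not[OF definable_le[OF assms(2,1)]] by (simp add: not_le)

lemma definable_abs:
  assumes "definable_term g"
  shows "definable_term (\<lambda>\<rho>. \<bar>g \<rho>\<bar>)"
proof -
  have eq: "x = \<bar>y\<bar> \<longleftrightarrow> 0 \<le> x \<and> x * x = y * y" for x y :: real
    by (auto simp: square_eq_iff)
  show ?thesis
    unfolding definable_term_def eq
    by (intro definable_conj definable_le definable_eq definable_mult definable_var definable_const
        definable_term_shift assms)
qed

lemma definable_component: "definable_term (g i) \<Longrightarrow> definable_term (\<lambda>\<rho>. (\<chi> j. g j \<rho>) $ i)"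
  by simp

lemma definable_finite_all:
  assumes "finite I" "\<And>i. definable_pred (P i)"
  shows "definable_pred (\<lambda>\<rho>. \<forall>i\<in>I. P i \<rho>)"
  using assms(1)
proof induction
  case empty
  then show ?case using definable_eq[OF definable_const[of 0] definable_const[of 0]] by simp
qed (auto intro: definable_conj assms(2))

text \<open>
  The induction substitutes the last term after the others, which therefore have to be shifted
  past its variable.
\<close>

lemma definable_subst_prefix:
  assumes "definable_pred P" "\<And>j. definable_term (g j)"
  shows "definable_pred (\<lambda>\<rho>. P (\<lambda>i. if i < m then g i \<rho> else \<rho> (i - m)))"
  using assms(2)
proof (induction m arbitrary: g)
  case 0
  then show ?case using assms(1) by simp
next
  case (Suc m)
  let ?Q = "\<lambda>\<rho> t. P (\<lambda>i. if i < m then g i \<rho> else if i = m then t else \<rho> (i - Suc m))"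
  have "(\<lambda>i. if i < m then g i (\<lambda>i. \<rho> (Suc i)) else \<rho> (i - m))
      = (\<lambda>i. if i < m then g i (\<lambda>i. \<rho> (Suc i)) else if i = m then \<rho> 0
          else \<rho> (Suc (i - Suc m)))" for \<rho> :: "nat \<Rightarrow> real"
    by (auto simp: fun_eq_iff Suc_diff_Suc)
  with Suc.IH[of "\<lambda>j \<rho>. g j (\<lambda>i. \<rho> (Suc i))"] Suc.prems
  have "definable_pred (\<lambda>\<rho>. ?Q (\<lambda>i. \<rho> (Suc i)) (\<rho> 0))"
    by (simp add: definable_term_shift)
  from definable_inst[OF this Suc.prems[of m]] show ?case
    by (rule back_subst[of definable_pred]) (auto simp: fun_eq_iff less_Suc_eq intro!: arg_cong[of _ _ P])
qed

lemma definable_mem: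
  assumes "A \<in> D m" "\<And>j. definable_term (g j)"
  shows "definable_pred (\<lambda>\<rho>. map (\<lambda>j. g j \<rho>) [0..<m] \<in> A)"
proof -
  have "definable_pred (\<lambda>\<rho>. map \<rho> [0..<m] \<in> A)" by (rule definable_predI[OF assms(1)]) simp
  from definable_subst_prefix[OF this assms(2), of m] show ?thesis
    by (rule back_subst[of definable_pred]) (auto simp: fun_eq_iff intro!: arg_cong[of _ _ "\<lambda>x. x \<in> A"])
qed

lemma definable_ex_list:
  assumes "definable_pred (\<lambda>\<rho>. Q (\<lambda>i. \<rho> (i + n)) (map \<rho> [0..<n]))"
  shows "definable_pred (\<lambda>\<rho>. \<exists>xs. length xs = n \<and> Q \<rho> xs)"
  using assms
proof (induction n arbitrary: Q)
  case 0
  then show ?case by simp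
next
  case (Suc n)
  let ?Q = "\<lambda>\<rho> xs. \<exists>t. Q \<rho> (t # xs)"
  have eq: "map \<rho> [0..<Suc n] = \<rho> 0 # map (\<lambda>i. \<rho> (Suc i)) [0..<n]" for \<rho> :: "nat \<Rightarrow> real"
    by (simp add: map_upt_Suc del: upt_Suc)
  have "definable_pred (\<lambda>\<rho>. ?Q (\<lambda>i. \<rho> (i + n)) (map \<rho> [0..<n]))"
    using Suc.prems unfolding eq by (intro definable_ex) simp
  from Suc.IH[OF this] show ?case
    by (rule back_subst[of definable_pred]) (auto simp: fun_eq_iff length_Suc_conv)
qed

end

section \<open>Intervals of the real line\<close>

lemma interval_eventually:
  fixes I :: "real set"
  assumes "is_interval I" and F: "F = at_top \<or> F = at_right a"
  shows "(\<forall>\<^sub>F t in F. t \<in> I) \<or> (\<forall>\<^sub>F t in F. t \<notin> I)"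
proof (rule disjCI)
  assume "\<not> (\<forall>\<^sub>F t in F. t \<notin> I)"
  then have freq: "\<exists>\<^sub>F t in F. t \<in> I" by (simp add: frequently_def)
  have I: "u \<in> I" if "s \<in> I" "t \<in> I" "s \<le> u" "u \<le> t" for s t u
    using assms(1) that unfolding is_interval_1 by blast
  from F show "\<forall>\<^sub>F t in F. t \<in> I"
  proof
    assume F: "F = at_top"
    obtain s where s: "s \<in> I" using frequently_ex[OF freq] by blast
    have "t \<in> I" if "t \<ge> s" for t
      using frequently_ex[OF frequently_eventually_frequently[OF freq[unfolded F]
            eventually_ge_at_top[of t]]] I[OF s _ that] by blast
    then show ?thesis unfolding F eventually_at_top_linorder by blast
  next
    assume F: "F = at_right a"
    obtain s where s: "s \<in> I" "s > a"
      using frequently_ex[OF frequently_eventually_frequently[OF freq[unfolded F]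
            eventually_at_right_less]] by blast
    have "t \<in> I" if "t > a" "t < s" for t
    proof -
      have "\<forall>\<^sub>F u in at_right a. u < t" using that eventually_at_right_field by blast
      from frequently_ex[OF frequently_eventually_frequently[OF freq[unfolded F] this]]
      obtain u where "u \<in> I" "u < t" by blast
      with I[OF this(1) s(1)] that show ?thesis by simp
    qed
    then show ?thesis unfolding F eventually_at_right_field using s(2) by blast
  qed
qed

lemma interval_infinite_contains_open:
  fixes I :: "real set"
  assumes "is_interval I" "infinite (I \<inter> J)" and J: "is_interval J"
  shows "\<exists>c d. c < d \<and> {c<..<d} \<subseteq> I \<inter> J"
proof -
  obtain s where s: "s \<in> I \<inter> J" using assms(2) by (metis ex_in_conv finite.emptyI)
  have "infinite (I \<inter> J - {s})" using assms(2) by simp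
  then obtain t where t: "t \<in> I \<inter> J" "t \<noteq> s"
    by (metis Diff_iff ex_in_conv finite.emptyI insertI1)
  have IJ: "is_interval (I \<inter> J)" using assms(1) J by (rule is_interval_Int)
  have "{min s t<..<max s t} \<subseteq> I \<inter> J"
  proof
    fix u assume "u \<in> {min s t<..<max s t}"
    then have "(s \<le> u \<and> u \<le> t) \<or> (t \<le> u \<and> u \<le> s)" by auto
    then show "u \<in> I \<inter> J" using IJ s t(1) unfolding is_interval_1 by blast
  qed
  moreover have "min s t < max s t" using t by auto
  ultimately show ?thesis by blast
qed

section \<open>Weakly monotone functions on the line\<close>

definition weakly_monotone_on :: "real set \<Rightarrow> (real \<Rightarrow> real) \<Rightarrow> bool" where
  "weakly_monotone_on S h \<longleftrightarrow> mono_on S h \<or> monotone_on S (\<le>) (\<ge>) h"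

lemma weakly_monotone_on_subset:
  "weakly_monotone_on S h \<Longrightarrow> T \<subseteq> S \<Longrightarrow> weakly_monotone_on T h"
  unfolding weakly_monotone_on_def using monotone_on_subset by blast

lemma weakly_monotone_on_cong:
  "(\<And>t. t \<in> S \<Longrightarrow> h t = h' t) \<Longrightarrow> weakly_monotone_on S h \<longleftrightarrow> weakly_monotone_on S h'"
  unfolding weakly_monotone_on_def monotone_on_def by auto

lemma weakly_monotone_on_bound:
  assumes "weakly_monotone_on {a..b} h" "t \<in> {a..b}"
  shows "\<bar>h t\<bar> \<le> \<bar>h a\<bar> + \<bar>h b\<bar>"
proof -
  have "(h a \<le> h t \<and> h t \<le> h b) \<or> (h b \<le> h t \<and> h t \<le> h a)"
    using assms unfolding weakly_monotone_on_def monotone_on_def by auto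
  then show ?thesis by arith
qed

text \<open>
  The increments of a monotone function have the same sign, so its variation telescopes.
\<close>

lemma weakly_monotone_on_variation:
  assumes h: "weakly_monotone_on S h" and "incseq p" and p: "\<And>k. k \<le> N \<Longrightarrow> p k \<in> S"
  shows "(\<Sum>k<N. \<bar>h (p (Suc k)) - h (p k)\<bar>) = \<bar>h (p N) - h (p 0)\<bar>"
proof -
  have le: "p k \<le> p l" if "k \<le> l" for k l using \<open>incseq p\<close> that by (rule incseqD)
  from h consider "mono_on S h" | "monotone_on S (\<le>) (\<ge>) h"
    unfolding weakly_monotone_on_def by blast
  then show ?thesis
  proof cases
    case 1
    then have m: "h (p k) \<le> h (p l)" if "k \<le> l" "l \<le> N" for k l
      using p le that by (auto simp: monotone_on_def)
    have "(\<Sum>k<N. \<bar>h (p (Suc k)) - h (p k)\<bar>) = (\<Sum>k<N. h (p (Suc k)) - h (p k))"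
      by (rule sum.cong) (auto simp: m)
    then show ?thesis using m[of 0 N] by (simp add: sum_lessThan_telescope[of "\<lambda>k. h (p k)"])
  next
    case 2
    then have m: "h (p l) \<le> h (p k)" if "k \<le> l" "l \<le> N" for k l
      using p le that by (auto simp: monotone_on_def)
    have "(\<Sum>k<N. \<bar>h (p (Suc k)) - h (p k)\<bar>) = (\<Sum>k<N. - (h (p (Suc k)) - h (p k)))"
      by (rule sum.cong) (auto simp: m)
    then show ?thesis using m[of 0 N] 
      unfolding sum_negf by (simp add: sum_lessThan_telescope[of "\<lambda>k. h (p k)"])
  qed
qed

section \<open>Tameness of definable sets of real numbers\<close>

context o_minimal_structure
begin

lemma definable_set_intervals:
  assumes "definable_pred (\<lambda>\<rho>. \<rho> 0 \<in> S)"
  obtains \<I> where "finite \<I>" "\<And>I. I \<in> \<I> \<Longrightarrow> is_interval I" "S = \<Union>\<I>"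
proof -
  obtain N where N: "\<And>m. m \<ge> N \<Longrightarrow> \<exists>A\<in>D m. \<forall>\<rho>. \<rho> 0 \<in> S \<longleftrightarrow> map \<rho> [0..<m] \<in> A"
    using definable_pred_level[OF assms] by blast
  obtain A where A: "A \<in> D (1 + N)" "\<And>\<rho>. \<rho> 0 \<in> S \<longleftrightarrow> map \<rho> [0..<1 + N] \<in> A"
    using N[of "1 + N"] by auto
  have "t \<in> S \<longleftrightarrow> [t] \<in> take 1 ` A" for t
  proof
    assume "t \<in> S"
    then have "map (\<lambda>i. t) [0..<1 + N] \<in> A" using A(2)[of "\<lambda>i. t"] by simp
    moreover have "take 1 (map (\<lambda>i. t) [0..<1 + N]) = [t]" by (simp add: upt_rec)
    ultimately show "[t] \<in> take 1 ` A" by (metis imageI)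
  next
    assume "[t] \<in> take 1 ` A"
    then obtain xs where xs: "xs \<in> A" "[t] = take 1 xs" by blast
    have len: "length xs = 1 + N" using D_length[OF A(1) xs(1)] .
    have "map (\<lambda>i. xs ! i) [0..<1 + N] = xs" using len by (metis map_nth)
    then have "xs ! 0 \<in> S" using A(2)[of "\<lambda>i. xs ! i"] xs(1) by simp
    moreover have "xs ! 0 = t" using xs(2) len by (cases xs) auto
    ultimately show "t \<in> S" by simp
  qed
  then have "{t. [t] \<in> take 1 ` A} = S" by blast
  with o_minimal[OF D_project[OF A(1)]] that show ?thesis by auto
qed

text \<open>
  The axiom on subsets of the line is used in two forms: a definable set does not oscillate near
  \<open>+\<infinity>\<close> or to the right of a point, and it contains an open interval as soon as it is infinite.
\<close>

lemma definable_eventually: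
  assumes "definable_pred (\<lambda>\<rho>. \<rho> 0 \<in> S)" and F: "F = at_top \<or> F = at_right (a::real)"
  shows "(\<forall>\<^sub>F t in F. t \<in> S) \<or> (\<forall>\<^sub>F t in F. t \<notin> S)"
proof -
  obtain \<I> where \<I>: "finite \<I>" "\<And>I. I \<in> \<I> \<Longrightarrow> is_interval I" "S = \<Union>\<I>"
    using definable_set_intervals[OF assms(1)] by blast
  show ?thesis
  proof (cases "\<exists>I\<in>\<I>. \<forall>\<^sub>F t in F. t \<in> I")
    case True
    then show ?thesis unfolding \<I>(3) by (auto elim: eventually_mono)
  next
    case False
    then have "\<forall>I\<in>\<I>. \<forall>\<^sub>F t in F. t \<notin> I" using interval_eventually[OF \<I>(2) F] by blast
    from eventually_ball_finite[OF \<I>(1) this] show ?thesis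
      unfolding \<I>(3) by (auto elim: eventually_mono)
  qed
qed

lemma definable_infinite_contains_open:
  assumes "definable_pred (\<lambda>\<rho>. \<rho> 0 \<in> S)" "infinite (S \<inter> J)" and J: "is_interval J"
  shows "\<exists>c d. c < d \<and> {c<..<d} \<subseteq> S \<inter> J"
proof -
  obtain \<I> where \<I>: "finite \<I>" "\<And>I. I \<in> \<I> \<Longrightarrow> is_interval I" "S = \<Union>\<I>"
    using definable_set_intervals[OF assms(1)] by blast
  have eq: "S \<inter> J = (\<Union>I\<in>\<I>. I \<inter> J)" unfolding \<I>(3) by blast
  obtain I where "I \<in> \<I>" "infinite (I \<inter> J)" using assms(2) \<I>(1) unfolding eq by blast
  with interval_infinite_contains_open[OF \<I>(2) _ J] show ?thesis unfolding \<I>(3) by blast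
qed

lemma open_interval_subset_bounds:
  fixes a b c d :: real
  assumes "c < d" "{c<..<d} \<subseteq> {a<..<b}"
  shows "a \<le> c" "d \<le> b"
  using assms greaterThanLessThan_subseteq_greaterThanLessThan[of c d a b] by auto

text \<open>
  The Baire-type principle: an interval is uncountable, so not all pieces of a countable cover can be
  finite, and an infinite definable piece contains an interval.
\<close>

lemma definable_countable_cover:
  fixes S :: "'k::countable \<Rightarrow> real set"
  assumes def: "\<And>k. definable_pred (\<lambda>\<rho>. \<rho> 0 \<in> S k)"
    and "a < b" and cover: "{a<..<b} \<subseteq> (\<Union>k. S k)"
  obtains k c d where "a \<le> c" "c < d" "d \<le> b" "{c<..<d} \<subseteq> S k"
proof -
  have "\<exists>k. infinite (S k \<inter> {a<..<b})"
  proof (rule ccontr)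
    assume "\<nexists>k. infinite (S k \<inter> {a<..<b})"
    then have "countable (\<Union>k. S k \<inter> {a<..<b})" by (intro countable_UN) (auto intro: countable_finite)
    moreover have "(\<Union>k. S k \<inter> {a<..<b}) = {a<..<b}" using cover by blast
    ultimately show False using uncountable_open_interval[of a b] \<open>a < b\<close> by simp
  qed
  then obtain k c d where "c < d" "{c<..<d} \<subseteq> S k \<inter> {a<..<b}"
    using definable_infinite_contains_open[OF def] is_interval_oo by blast
  with that[of c d k] open_interval_subset_bounds[of c d a b] show ?thesis by blast
qed

text \<open>
  This is the device for choosing points definably: a finite set has a minimum, and in a set with
  interior a rational interior point is the minimum of the part above it. Only countably many
  parameters \<open>q\<close> occur, so that \<open>definable_countable_cover\<close> applies to them.
\<close>

lemma definable_has_min_above_rat: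
  assumes def: "definable_pred (\<lambda>\<rho>. \<rho> 0 \<in> S)" and "S \<noteq> {}"
  shows "\<exists>q::rat. \<exists>s\<in>S. of_rat q \<le> s \<and> (\<forall>s'\<in>S. of_rat q \<le> s' \<longrightarrow> s \<le> s')"
proof (cases "finite S")
  case True
  obtain q where q: "of_rat q < Min S" using of_rat_dense[of "Min S - 1" "Min S"] by auto
  then show ?thesis using True assms(2)
    by (intro exI[of _ q] bexI[of _ "Min S"]) auto
next
  case False
  then obtain c d where cd: "c < d" "{c<..<d} \<subseteq> S"
    using definable_infinite_contains_open[OF def, of UNIV] by auto
  obtain q where "c < of_rat q" "of_rat q < d" using of_rat_dense[OF cd(1)] by blast
  then have "of_rat q \<in> S" using cd(2) by auto
  then show ?thesis by blast
qed

text \<open>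
  Immediately to the right of each \<open>t\<close>, either all values of \<open>h\<close> are at least \<open>h t\<close> or all are
  smaller. The type of behaviour and the length of the interval on which it is seen
  can be made uniform on a subinterval. There the comparison holds between any two points
  that are close enough, which is monotonicity. The function is given by a relation \<open>H\<close> because it
  need not be definable outside of the interval.
\<close>

lemma monotone_on_subinterval:
  fixes h :: "real \<Rightarrow> real"
  assumes H: "\<And>i j. definable_pred (\<lambda>\<rho>. H (\<rho> i) (\<rho> j))"
    and "a < b" and h: "\<And>t s. t \<in> {a<..<b} \<Longrightarrow> H t s \<longleftrightarrow> s = h t"
  obtains c d where "a \<le> c" "c < d" "d \<le> b" "weakly_monotone_on {c<..<d} h"
proof -
  define R :: "nat \<Rightarrow> real \<Rightarrow> real \<Rightarrow> bool" where
    "R m x y = (if m = 0 then x \<le> y else y \<le> x)" for m x y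
  define S where "S = (\<lambda>(m, k).
    {t. \<forall>u. t < u \<longrightarrow> u < t + inverse (real (Suc k)) \<longrightarrow>
      (\<forall>x y. H t x \<longrightarrow> H u y \<longrightarrow> R m x y)})"
  have R: "definable_pred (\<lambda>\<rho>. R m (\<rho> i) (\<rho> j))" for m i j
    unfolding R_def by (cases "m = 0") (auto intro: definable_le definable_var)
  have def_S: "definable_pred (\<lambda>\<rho>. \<rho> 0 \<in> S p)" for p
    unfolding S_def split_beta mem_Collect_eq
    by (intro definable_all definable_imp H R definable_less definable_add definable_var
        definable_const)
  have cover: "{a<..<b} \<subseteq> (\<Union>p. S p)"
  proof
    fix t assume t: "t \<in> {a<..<b}"
    have "definable_pred (\<lambda>\<rho>. \<rho> 0 \<in> {u. \<exists>z x y. z = t \<and> H z x \<and> H u y \<and> x \<le> y})"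
      unfolding mem_Collect_eq
      by (intro definable_ex definable_conj H definable_le definable_eq definable_var
          definable_const)
    then have "(\<forall>\<^sub>F u in at_right t. u \<in> {u. \<exists>z x y. z = t \<and> H z x \<and> H u y \<and> x \<le> y}) \<or>
        (\<forall>\<^sub>F u in at_right t. u \<notin> {u. \<exists>z x y. z = t \<and> H z x \<and> H u y \<and> x \<le> y})"
      by (rule definable_eventually[of _ _ t]) simp
    then have "\<exists>v>t. \<exists>m. \<forall>u x y. t < u \<longrightarrow> u < v \<longrightarrow> H t x \<longrightarrow> H u y \<longrightarrow> R m x y"
    proof
      \<comment> \<open>\<open>H\<close> is known to be a function only inside the interval, so \<open>u < b\<close> is ensured as well.\<close>
      assume "\<forall>\<^sub>F u in at_right t. u \<in> {u. \<exists>z x y. z = t \<and> H z x \<and> H u y \<and> x \<le> y}"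
      then have "\<forall>\<^sub>F u in at_right t. u < b \<and> (\<exists>x y. H t x \<and> H u y \<and> x \<le> y)"
        using eventually_at_right_less[of t] t eventually_at_right_field
        by (intro eventually_conj) auto
      then obtain v where v: "v > t"
        "\<And>u. t < u \<Longrightarrow> u < v \<Longrightarrow> u < b \<and> (\<exists>x y. H t x \<and> H u y \<and> x \<le> y)"
        unfolding eventually_at_right_field by blast
      have "x \<le> y" if "t < u" "u < v" "H t x" "H u y" for u x y
      proof -
        have "u \<in> {a<..<b}" using v(2)[of u] that t by auto
        then show ?thesis using v(2)[of u] that h[OF t] h[of u] by metis
      qed
      then have "\<forall>u x y. t < u \<longrightarrow> u < v \<longrightarrow> H t x \<longrightarrow> H u y \<longrightarrow> R 0 x y"
        by (simp add: R_def)
      then show ?thesis using v(1) by blast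
    next
      assume "\<forall>\<^sub>F u in at_right t. u \<notin> {u. \<exists>z x y. z = t \<and> H z x \<and> H u y \<and> x \<le> y}"
      then obtain v where v: "v > t"
        "\<And>u x y. t < u \<Longrightarrow> u < v \<Longrightarrow> H t x \<Longrightarrow> H u y \<Longrightarrow> \<not> x \<le> y"
        unfolding eventually_at_right_field by blast
      then have "\<forall>u x y. t < u \<longrightarrow> u < v \<longrightarrow> H t x \<longrightarrow> H u y \<longrightarrow> R 1 x y"
        using linear unfolding R_def by (simp only: one_neq_zero if_False) blast
      then show ?thesis using v(1) by blast
    qed
    then obtain v m where v: "v > t" and vm: "\<And>u x y. t < u \<Longrightarrow> u < v \<Longrightarrow>
        H t x \<Longrightarrow> H u y \<Longrightarrow> R m x y" by blast
    obtain k where k: "inverse (real (Suc k)) < v - t"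
      using reals_Archimedean[of "v - t"] v by auto
    have "R m x y" if "t < u" "u < t + inverse (real (Suc k))" "H t x" "H u y" for u x y
      by (rule vm[OF that(1) _ that(3,4)]) (use that(2) k in linarith)
    then have "t \<in> S (m, k)" unfolding S_def prod.case mem_Collect_eq by blast
    then show "t \<in> (\<Union>p. S p)" by blast
  qed
  obtain p c d where cd: "a \<le> c" "c < d" "d \<le> b" "{c<..<d} \<subseteq> S p"
    by (rule definable_countable_cover[OF def_S \<open>a < b\<close> cover])
  obtain m k where p: "p = (m, k)" by (cases p)
  define d' where "d' = min d (c + inverse (real (Suc k)))"
  have "R m (h t) (h u)" if "t \<in> {c<..<d'}" "u \<in> {c<..<d'}" "t \<le> u" for t u
  proof (cases "t = u")
    case False
    have "t \<in> S (m, k)" using that cd p by (auto simp: d'_def)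
    moreover have "t < u" "u < t + inverse (real (Suc k))"
      using that False by (auto simp: d'_def)
    ultimately have "\<forall>x y. H t x \<longrightarrow> H u y \<longrightarrow> R m x y"
      unfolding S_def prod.case mem_Collect_eq by blast
    moreover have "H t (h t)" "H u (h u)" using h that cd by (auto simp: d'_def)
    ultimately show ?thesis by blast
  qed (simp add: R_def)
  then have "weakly_monotone_on {c<..<d'} h"
    unfolding weakly_monotone_on_def by (cases "m = 0") (auto simp: R_def monotone_on_def)
  moreover have "c < d'" "d' \<le> b" using cd by (auto simp: d'_def)
  ultimately show ?thesis using cd(1) that by blast
qed

end

section \<open>Sections with monotone coordinates\<close>

locale definable_function = o_minimal_structure D
  for D :: "nat \<Rightarrow> real list set set" +
  fixes e :: "nat \<Rightarrow> 'n::finite" and f :: "real ^ 'n \<Rightarrow> real"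
  assumes enum: "bij_betw e {..<CARD('n)} UNIV"
    and definable_graph: "definable_fun D e f"
begin

abbreviation position :: "'n \<Rightarrow> nat" where
  "position \<equiv> inv_into {..<CARD('n)} e"

lemma position_less: "position j < CARD('n)"
  using inv_into_into[of j e "{..<CARD('n)}"] enum by (auto simp: bij_betw_def)

lemma e_position: "e (position j) = j"
  using enum by (intro f_inv_into_f) (auto simp: bij_betw_def)

lemma coords_inject: "coords e x = coords e y \<Longrightarrow> x = y"
  unfolding coords_def vec_eq_iff using position_less e_position
  by (metis atLeastLessThan_upt atLeast0LessThan lessThan_iff map_eq_conv)

lemma definable_apply:
  assumes "\<And>j. definable_term (g j)"
  shows "definable_term (\<lambda>\<rho>. f (\<chi> j. g j \<rho>))"
proof -
  define G where "G = (\<lambda>j \<rho>. if j < CARD('n) then g (e j) (\<lambda>i. \<rho> (Suc i)) else \<rho> 0)"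
  have "definable_pred (\<lambda>\<rho>. map (\<lambda>j. G j \<rho>) [0..<Suc CARD('n)]
      \<in> range (\<lambda>x. coords e x @ [f x]))"
    by (rule definable_mem[OF definable_graph[unfolded definable_fun_def]])
      (unfold G_def, intro definable_if definable_term_shift[OF assms] definable_var)
  moreover have "map (\<lambda>j. G j \<rho>) [0..<Suc CARD('n)]
      = coords e (\<chi> j. g j (\<lambda>i. \<rho> (Suc i))) @ [\<rho> 0]" for \<rho> :: "nat \<Rightarrow> real"
    by (simp add: coords_def G_def)
  moreover have "coords e x @ [t] \<in> range (\<lambda>x. coords e x @ [f x]) \<longleftrightarrow> t = f x" for x t
    using coords_inject by auto
  ultimately show ?thesis unfolding definable_term_def by simp
qed

lemma definable_ex_vec:
  assumes "definable_pred (\<lambda>\<rho>. Q (\<lambda>i. \<rho> (i + CARD('n))) (\<chi> j. \<rho> (position j)))"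
  shows "definable_pred (\<lambda>\<rho>. \<exists>x :: real ^ 'n. Q \<rho> x)"
proof -
  have "definable_pred (\<lambda>\<rho>. \<exists>xs. length xs = CARD('n) \<and> Q \<rho> (\<chi> j. xs ! position j))"
    by (rule definable_ex_list) (use assms position_less in simp)
  moreover have "(\<exists>xs. length xs = CARD('n) \<and> Q \<rho> (\<chi> j. xs ! position j)) \<longleftrightarrow> (\<exists>x. Q \<rho> x)" for \<rho>
  proof
    assume "\<exists>x. Q \<rho> x"
    then obtain x where x: "Q \<rho> x" by blast
    have "(\<chi> j. coords e x ! position j) = x"
      using position_less by (simp add: coords_def vec_eq_iff e_position)
    with x show "\<exists>xs. length xs = CARD('n) \<and> Q \<rho> (\<chi> j. xs ! position j)"
      by (intro exI[of _ "coords e x"]) (simp add: coords_def)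
  qed blast
  ultimately show ?thesis by simp
qed

lemma definable_all_vec:
  assumes "definable_pred (\<lambda>\<rho>. Q (\<lambda>i. \<rho> (i + CARD('n))) (\<chi> j. \<rho> (position j)))"
  shows "definable_pred (\<lambda>\<rho>. \<forall>x :: real ^ 'n. Q \<rho> x)"
  using definable_not[OF definable_ex_vec[of "\<lambda>\<rho> x. \<not> Q \<rho> x"]] definable_not[OF assms] by simp

text \<open>
  The \<open>i\<close>-th coordinate of a solution is made unique by taking the least one above a rational \<open>q\<close>;
  some \<open>q\<close> works on a whole subinterval.
\<close>

lemma monotone_selection_step:
  fixes P :: "real \<Rightarrow> real ^ 'n \<Rightarrow> bool"
  assumes P: "\<And>k ix. definable_pred (\<lambda>\<rho>. P (\<rho> k) (\<chi> j. \<rho> (ix j)))"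
    and "a < b" and ex: "\<And>t. t \<in> {a<..<b} \<Longrightarrow> \<exists>x. P t x"
  obtains c d Q h where "a \<le> c" "c < d" "d \<le> b"
    "\<forall>k ix. definable_pred (\<lambda>\<rho>. Q (\<rho> k) (\<chi> j. \<rho> (ix j)))"
    "\<forall>t\<in>{c<..<d}. \<exists>x. Q t x"
    "\<forall>t x. Q t x \<longrightarrow> P t x"
    "weakly_monotone_on {c<..<d} h"
    "\<forall>t\<in>{c<..<d}. \<forall>x. Q t x \<longrightarrow> x $ i = h t"
proof -
  define Q where "Q = (\<lambda>q::rat. \<lambda>t x. P t x \<and> of_rat q \<le> x $ i \<and>
    (\<forall>y. P t y \<longrightarrow> of_rat q \<le> y $ i \<longrightarrow> x $ i \<le> y $ i))"
  have Q: "definable_pred (\<lambda>\<rho>. Q q (\<rho> k) (\<chi> j. \<rho> (ix j)))" for q k ix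
    unfolding Q_def
    by (intro definable_conj definable_all_vec definable_imp P definable_le definable_component
        definable_var definable_const)
  have def_S: "definable_pred (\<lambda>\<rho>. \<rho> 0 \<in> {t. \<exists>x. Q q t x})" for q
    unfolding mem_Collect_eq by (intro definable_ex_vec Q)
  have cover: "{a<..<b} \<subseteq> (\<Union>q. {t. \<exists>x. Q q t x})"
  proof
    fix t assume t: "t \<in> {a<..<b}"
    define A where "A = {s. \<exists>z x. z = t \<and> P z x \<and> s = x $ i}"
    have "definable_pred (\<lambda>\<rho>. \<rho> 0 \<in> A)"
      unfolding A_def mem_Collect_eq
      by (intro definable_ex definable_ex_vec definable_conj P definable_eq definable_component
          definable_var definable_const)
    moreover have "A \<noteq> {}" using ex[OF t] unfolding A_def by blast
    ultimately obtain q s where qs: "s \<in> A" "of_rat q \<le> s"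
      "\<forall>s'\<in>A. of_rat q \<le> s' \<longrightarrow> s \<le> s'"
      using definable_has_min_above_rat[of A] by blast
    then obtain x where x: "P t x" "s = x $ i" unfolding A_def by blast
    have "x $ i \<le> y $ i" if "P t y" "of_rat q \<le> y $ i" for y
      using qs(3) that x(2) unfolding A_def by blast
    with qs(2) x have "Q q t x" unfolding Q_def by blast
    then show "t \<in> (\<Union>q. {t. \<exists>x. Q q t x})" by blast
  qed
  obtain q c d where cd: "a \<le> c" "c < d" "d \<le> b" "{c<..<d} \<subseteq> {t. \<exists>x. Q q t x}"
    by (rule definable_countable_cover[OF def_S \<open>a < b\<close> cover])
  define h where "h t = (SOME x. Q q t x) $ i" for t
  have unique: "x $ i = y $ i" if "Q q t x" "Q q t y" for t x y
    using that unfolding Q_def by (meson order_antisym)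
  have h: "x $ i = h t" if "Q q t x" for t x
    unfolding h_def using unique[OF that someI[of "Q q t", OF that]] .
  have H: "definable_pred (\<lambda>\<rho>. \<exists>x. Q q (\<rho> k) x \<and> \<rho> l = x $ i)" for k l
    by (intro definable_ex_vec definable_conj Q definable_eq definable_component definable_var)
  have h_iff: "(\<exists>x. Q q t x \<and> s = x $ i) \<longleftrightarrow> s = h t" if t: "t \<in> {c<..<d}" for t s
  proof -
    obtain x where "Q q t x" using cd(4) t by blast
    then show ?thesis using h by metis
  qed
  obtain c' d' where "c \<le> c'" "c' < d'" "d' \<le> d" "weakly_monotone_on {c'<..<d'} h"
    by (rule monotone_on_subinterval[OF H \<open>c < d\<close> h_iff])
  moreover have "{c'<..<d'} \<subseteq> {c<..<d}" using calculation by auto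
  then have "\<forall>t\<in>{c'<..<d'}. \<exists>x. Q q t x" using cd(4) by blast
  moreover note this
  moreover have "\<forall>t x. Q q t x \<longrightarrow> P t x" by (simp add: Q_def)
  moreover have "\<forall>t\<in>{c'<..<d'}. \<forall>x. Q q t x \<longrightarrow> x $ i = h t" using h by blast
  moreover have "a \<le> c'" "d' \<le> b" using calculation cd by auto
  moreover have "\<forall>k ix. definable_pred (\<lambda>\<rho>. Q q (\<rho> k) (\<chi> j. \<rho> (ix j)))" using Q by simp
  ultimately show ?thesis using that[of c' d' "Q q" h] by simp
qed

text \<open>
  Treating the coordinates one at a time, the solution set is cut down to a definable set in which
  each coordinate is a function of the parameter and monotone in it.
\<close>

lemma monotone_selection:
  fixes P :: "real \<Rightarrow> real ^ 'n \<Rightarrow> bool"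
  assumes P: "\<And>k ix. definable_pred (\<lambda>\<rho>. P (\<rho> k) (\<chi> j. \<rho> (ix j)))"
    and "a < b" and ex: "\<And>t. t \<in> {a<..<b} \<Longrightarrow> \<exists>x. P t x"
  obtains g c d where "a \<le> c" "c < d" "d \<le> b" "\<And>t. t \<in> {c<..<d} \<Longrightarrow> P t (g t)"
    "\<And>i. weakly_monotone_on {c<..<d} (\<lambda>t. g t $ i)"
proof -
  have "\<exists>Q c d. a \<le> c \<and> c < d \<and> d \<le> b \<and>
      (\<forall>k ix. definable_pred (\<lambda>\<rho>. Q (\<rho> k) (\<chi> j. \<rho> (ix j)))) \<and>
      (\<forall>t\<in>{c<..<d}. \<exists>x. Q t x) \<and> (\<forall>t x. Q t x \<longrightarrow> P t x) \<and>
      (\<forall>i\<in>I. \<exists>h. weakly_monotone_on {c<..<d} h \<and> (\<forall>t\<in>{c<..<d}. \<forall>x. Q t x \<longrightarrow> x $ i = h t))"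
    if "finite I" for I :: "'n set"
    using that
  proof induction
    case empty
    show ?case
      by (rule exI[of _ P], rule exI[of _ a], rule exI[of _ b]) (use P ex \<open>a < b\<close> in simp)
  next
    case (insert i I)
    then obtain Q c d where Q: "a \<le> c" "c < d" "d \<le> b"
      "\<And>k ix. definable_pred (\<lambda>\<rho>. Q (\<rho> k) (\<chi> j. \<rho> (ix j)))"
      "\<And>t. t \<in> {c<..<d} \<Longrightarrow> \<exists>x. Q t x" "\<And>t x. Q t x \<Longrightarrow> P t x"
      and I: "\<And>i. i \<in> I \<Longrightarrow> \<exists>h. weakly_monotone_on {c<..<d} h \<and>
        (\<forall>t\<in>{c<..<d}. \<forall>x. Q t x \<longrightarrow> x $ i = h t)"
      by blast
    obtain c' d' Q' h where Q': "c \<le> c'" "c' < d'" "d' \<le> d"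
      "\<forall>k ix. definable_pred (\<lambda>\<rho>. Q' (\<rho> k) (\<chi> j. \<rho> (ix j)))"
      "\<forall>t\<in>{c'<..<d'}. \<exists>x. Q' t x" "\<forall>t x. Q' t x \<longrightarrow> Q t x"
      and h: "weakly_monotone_on {c'<..<d'} h"
        "\<forall>t\<in>{c'<..<d'}. \<forall>x. Q' t x \<longrightarrow> x $ i = h t"
      by (rule monotone_selection_step[OF Q(4) Q(2) Q(5), where i = i])
    have sub: "{c'<..<d'} \<subseteq> {c<..<d}" using Q' by auto
    have "\<exists>h. weakly_monotone_on {c'<..<d'} h \<and> (\<forall>t\<in>{c'<..<d'}. \<forall>x. Q' t x \<longrightarrow> x $ l = h t)"
      if l: "l \<in> insert i I" for l
    proof (cases "l = i")
      case True
      then show ?thesis using h by blast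
    next
      case False
      then obtain h' where "weakly_monotone_on {c<..<d} h'"
        "\<forall>t\<in>{c<..<d}. \<forall>x. Q t x \<longrightarrow> x $ l = h' t" using l I by blast
      then have "weakly_monotone_on {c'<..<d'} h'" "\<forall>t\<in>{c'<..<d'}. \<forall>x. Q' t x \<longrightarrow> x $ l = h' t"
        using weakly_monotone_on_subset[OF _ sub] sub Q'(6) by auto
      then show ?thesis by blast
    qed
    moreover have "a \<le> c'" "d' \<le> b" using Q Q' by auto
    moreover have "\<forall>t x. Q' t x \<longrightarrow> P t x" using Q(6) Q'(6) by simp
    ultimately show ?case
      using Q'(2,4,5) by (intro exI[of _ Q'] exI[of _ c'] exI[of _ d'] conjI ballI) simp_all
  qed
  from this[of UNIV] obtain Q c d where Q: "a \<le> c" "c < d" "d \<le> b"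
    "\<forall>t\<in>{c<..<d}. \<exists>x. Q t x" "\<forall>t x. Q t x \<longrightarrow> P t x"
    and mono: "\<forall>i. \<exists>h. weakly_monotone_on {c<..<d} h \<and> (\<forall>t\<in>{c<..<d}. \<forall>x. Q t x \<longrightarrow> x $ i = h t)"
    by auto
  define g where "g t = (SOME x. Q t x)" for t
  have g: "Q t (g t)" if "t \<in> {c<..<d}" for t
    unfolding g_def using Q(4) that by (metis someI_ex)
  have "weakly_monotone_on {c<..<d} (\<lambda>t. g t $ i)" for i
  proof -
    from mono obtain h where h: "weakly_monotone_on {c<..<d} h"
      "\<forall>t\<in>{c<..<d}. \<forall>x. Q t x \<longrightarrow> x $ i = h t" by blast
    then show ?thesis using weakly_monotone_on_cong[of "{c<..<d}" h "\<lambda>t. g t $ i"] g by simp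
  qed
  with that[of c d g] Q g show ?thesis by blast
qed

end

section \<open>Sard's theorem for flat definable sets\<close>

context definable_function
begin

text \<open>
  Flatness makes a section \<open>g\<close> of \<open>f\<close> over an interval vary by at least a multiple of
  \<open>\<bar>t - s\<bar> powr (1/2)\<close>, which is incompatible with bounded variation. Quantitatively, if \<open>V\<close> is the
  total variation of the coordinates, then among \<open>N\<close> equal steps of length \<open>(d - c) / N\<close> there is
  one on which \<open>g\<close> varies by at most \<open>V / N\<close>, so that \<open>(d - c) / N \<le> L * (V / N)\<^sup>2\<close>. This fails for
  large \<open>N\<close>.
\<close>

lemma finite_image_if_quadratically_flat:
  assumes C: "\<And>ix. definable_pred (\<lambda>\<rho>. (\<chi> j. \<rho> (ix j)) \<in> C)"
    and quad: "\<And>r. \<exists>L. \<forall>x\<in>C \<inter> cball 0 r. \<forall>y\<in>C \<inter> cball 0 r. \<bar>f x - f y\<bar> \<le> L * (norm (x - y))\<^sup>2"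
  shows "finite (f ` C)"
proof (rule ccontr)
  assume inf: "infinite (f ` C)"
  have def_image: "definable_pred (\<lambda>\<rho>. \<rho> 0 \<in> f ` C)"
  proof -
    have "definable_pred (\<lambda>\<rho>. \<exists>x. x \<in> C \<and> \<rho> 0 = f (\<chi> j. x $ j))"
      by (intro definable_ex_vec definable_conj C definable_eq definable_var definable_apply
          definable_component)
    then show ?thesis by (simp add: image_iff Bex_def)
  qed
  obtain a b where ab: "a < b" "{a<..<b} \<subseteq> f ` C"
    using definable_infinite_contains_open[OF def_image, of UNIV] inf by auto
  have P: "definable_pred (\<lambda>\<rho>. (\<chi> j. \<rho> (ix j)) \<in> C \<and> f (\<chi> j. \<rho> (ix j)) = \<rho> k)" for k ix
    by (intro definable_conj C definable_eq definable_var definable_apply)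
  have ex: "\<exists>x. x \<in> C \<and> f x = t" if "t \<in> {a<..<b}" for t using ab that by blast
  obtain g c0 d0 where g: "a \<le> c0" "c0 < d0" "d0 \<le> b"
    "\<And>t. t \<in> {c0<..<d0} \<Longrightarrow> g t \<in> C \<and> f (g t) = t"
    and mono0: "\<And>i. weakly_monotone_on {c0<..<d0} (\<lambda>t. g t $ i)"
    by (rule monotone_selection[OF P ab(1) ex]) blast+
  \<comment> \<open>A compact subinterval, on which the monotone coordinates of \<open>g\<close> are bounded.\<close>
  define c where "c = c0 + (d0 - c0) / 3"
  define d where "d = c0 + 2 * (d0 - c0) / 3"
  have cd: "c < d" "{c..d} \<subseteq> {c0<..<d0}"
    using g(2) by (auto simp: c_def d_def field_simps)
  have mono: "weakly_monotone_on {c..d} (\<lambda>t. g t $ i)" for i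
    using weakly_monotone_on_subset[OF mono0 cd(2)] .
  define r where "r = (\<Sum>i\<in>UNIV. \<bar>g c $ i\<bar> + \<bar>g d $ i\<bar>)"
  define V where "V = (\<Sum>i\<in>UNIV. \<bar>g d $ i - g c $ i\<bar>)"
  have g_ball: "g t \<in> C \<inter> cball 0 r" if "t \<in> {c..d}" for t
  proof -
    have "norm (g t) \<le> (\<Sum>i\<in>UNIV. \<bar>g t $ i\<bar>)" by (rule norm_le_l1_cart)
    also have "\<dots> \<le> r" unfolding r_def
      by (intro sum_mono weakly_monotone_on_bound[OF mono that])
    finally show ?thesis using g(4) cd(2) that by auto
  qed
  obtain L0 where L0: "\<And>x y. x \<in> C \<inter> cball 0 r \<Longrightarrow> y \<in> C \<inter> cball 0 r \<Longrightarrow>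
      \<bar>f x - f y\<bar> \<le> L0 * (norm (x - y))\<^sup>2"
    using quad[of r] by blast
  define L where "L = \<bar>L0\<bar>"
  have L: "\<bar>t - s\<bar> \<le> L * (\<Sum>i\<in>UNIV. \<bar>g t $ i - g s $ i\<bar>)\<^sup>2" if "t \<in> {c..d}" "s \<in> {c..d}" for t s
  proof -
    have "\<bar>t - s\<bar> \<le> L0 * (norm (g t - g s))\<^sup>2"
      using L0[OF g_ball[OF that(1)] g_ball[OF that(2)]] g(4) cd(2) that by (metis subsetD)
    also have "\<dots> \<le> L * (norm (g t - g s))\<^sup>2"
      unfolding L_def by (intro mult_right_mono) auto
    also have "\<dots> \<le> L * (\<Sum>i\<in>UNIV. \<bar>(g t - g s) $ i\<bar>)\<^sup>2"
      unfolding L_def by (intro mult_left_mono power_mono norm_le_l1_cart) auto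
    finally show ?thesis by simp
  qed
  have bound: "real N * (d - c) \<le> L * V\<^sup>2" if "N > 0" for N
  proof -
    \<comment> \<open>The \<open>min\<close> stops the subdivision at \<open>d\<close>, which makes \<open>p\<close> monotone on all of \<open>nat\<close>.\<close>
    define p where "p k = c + real (min k N) * (d - c) / real N" for k
    have p_mem: "p k \<in> {c..d}" for k
    proof -
      have "real (min k N) / real N \<le> 1" using \<open>N > 0\<close> by simp
      from mult_right_mono[OF this, of "d - c"] show ?thesis
        using cd(1) by (simp add: p_def)
    qed
    have p_inc: "incseq p"
      unfolding p_def using cd(1)
      by (intro incseq_SucI add_left_mono divide_right_mono mult_right_mono) auto
    have p_ends: "p 0 = c" "p N = d" using \<open>N > 0\<close> by (simp_all add: p_def)
    have p_step: "p (Suc k) - p k = (d - c) / N" if "k < N" for k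
      using that by (simp add: p_def min_def field_simps)
    define v where "v k = (\<Sum>i\<in>UNIV. \<bar>g (p (Suc k)) $ i - g (p k) $ i\<bar>)" for k
    have "(\<Sum>k<N. v k) = V"
      unfolding v_def V_def
      by (subst sum.swap)
        (simp add: weakly_monotone_on_variation[OF mono p_inc p_mem] p_ends)
    have "\<exists>k<N. v k \<le> V / N"
    proof (rule ccontr)
      assume "\<not> (\<exists>k<N. v k \<le> V / N)"
      then have "(\<Sum>k<N. V / N) < (\<Sum>k<N. v k)"
        using \<open>N > 0\<close> by (intro sum_strict_mono) auto
      with \<open>(\<Sum>k<N. v k) = V\<close> \<open>N > 0\<close> show False by simp
    qed
    then obtain k where k: "k < N" "v k \<le> V / N" by blast
    have "(d - c) / N \<le> \<bar>p (Suc k) - p k\<bar>" using p_step[OF k(1)] by (metis abs_ge_self)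
    also have "\<dots> \<le> L * (v k)\<^sup>2" unfolding v_def by (rule L[OF p_mem p_mem])
    also have "\<dots> \<le> L * (V / N)\<^sup>2"
      using k(2) unfolding L_def by (intro mult_left_mono power_mono) (auto simp: v_def sum_nonneg)
    finally have "(d - c) / N * N\<^sup>2 \<le> L * (V / N)\<^sup>2 * N\<^sup>2"
      by (intro mult_right_mono) auto
    moreover have "(d - c) / N * N\<^sup>2 = real N * (d - c)" using \<open>N > 0\<close> by (simp add: power2_eq_square)
    moreover have "L * (V / N)\<^sup>2 * N\<^sup>2 = L * V\<^sup>2" using \<open>N > 0\<close> by (simp add: power_divide)
    ultimately show ?thesis by metis
  qed
  obtain N where "L * V\<^sup>2 / (d - c) < real (Suc N)" using reals_Archimedean2 less_trans
    by (metis of_nat_less_iff lessI)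
  with bound[of "Suc N"] cd(1) show False by (simp add: field_simps)
qed

end

section \<open>Taylor estimates for smooth functions\<close>

lemma C_diff_1_lipschitz:
  fixes g :: "'a::euclidean_space \<Rightarrow> real"
  assumes "C_diff 1 g"
  shows "\<exists>K\<ge>0. \<forall>x\<in>cball 0 r. \<forall>y\<in>cball 0 r. \<bar>g x - g y\<bar> \<le> K * norm (x - y)"
proof -
  let ?D = "\<lambda>x. frechet_derivative g (at x)"
  have diff: "g differentiable (at x)" and cont: "continuous_on UNIV (\<lambda>x. ?D x v)" for x v
    using assms by (auto simp: One_nat_def)
  have "\<exists>K\<ge>0. \<forall>x\<in>cball 0 r. \<bar>?D x b\<bar> \<le> K" for b
  proof -
    have "compact ((\<lambda>x. ?D x b) ` cball 0 r)"
      by (intro compact_continuous_image continuous_on_subset[OF cont]) auto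
    then have "bounded ((\<lambda>x. ?D x b) ` cball 0 r)" by (rule compact_imp_bounded)
    then obtain K where "K > 0" "\<forall>x\<in>cball 0 r. norm (?D x b) \<le> K"
      unfolding bounded_pos by auto
    then show ?thesis by (intro exI[of _ K]) auto
  qed
  then obtain K where K: "\<And>b. K b \<ge> 0" "\<And>b x. x \<in> cball 0 r \<Longrightarrow> \<bar>?D x b\<bar> \<le> K b" by metis
  have onorm: "onorm (?D x) \<le> (\<Sum>b\<in>Basis. K b)" if x: "x \<in> cball 0 r" for x
  proof (rule onorm_le)
    fix v
    have lin: "bounded_linear (?D x)"
      using diff frechet_derivative_works has_derivative_bounded_linear by blast
    have "norm (?D x v) = \<bar>\<Sum>b\<in>Basis. (v \<bullet> b) * ?D x b\<bar>"
      using Linear_Algebra.linear_componentwise[of "?D x" v 1] lin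
      by (simp add: bounded_linear.linear)
    also have "\<dots> \<le> (\<Sum>b\<in>Basis. \<bar>(v \<bullet> b) * ?D x b\<bar>)" by (rule sum_abs)
    also have "\<dots> \<le> (\<Sum>b\<in>Basis. K b * norm v)"
    proof (rule sum_mono)
      fix b :: 'a assume "b \<in> Basis"
      then have "\<bar>v \<bullet> b\<bar> * \<bar>?D x b\<bar> \<le> norm v * K b"
        by (intro mult_mono K x Basis_le_norm) auto
      then show "\<bar>(v \<bullet> b) * ?D x b\<bar> \<le> K b * norm v" by (simp add: abs_mult mult.commute)
    qed
    finally show "norm (?D x v) \<le> (\<Sum>b\<in>Basis. K b) * norm v" by (simp add: sum_distrib_right)
  qed
  have "norm (g x - g y) \<le> (\<Sum>b\<in>Basis. K b) * norm (x - y)"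
    if "x \<in> cball 0 r" "y \<in> cball 0 r" for x y
    by (rule differentiable_bound[of "cball 0 r" g ?D])
      (use that onorm diff in \<open>auto simp: frechet_derivative_works intro: has_derivative_at_withinI\<close>)
  moreover have "(\<Sum>b\<in>Basis. K b) \<ge> 0" by (intro sum_nonneg K)
  ultimately show ?thesis by auto
qed

lemma grad_eqI: "GDERIV f x :> D \<Longrightarrow> grad f x = D"
  unfolding grad_def
proof (rule the_equality)
  fix E assume D: "GDERIV f x :> D" and E: "GDERIV f x :> E"
  have "(\<lambda>h. h \<bullet> E) = (\<lambda>h. h \<bullet> D)"
    using D E unfolding gderiv_def by (rule has_derivative_unique[symmetric])
  then show "E = D" by (metis inner_commute vector_eq_rdot)
qed

lemma smooth_grad:
  fixes f :: "'a::euclidean_space \<Rightarrow> real"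
  assumes "smooth f"
  shows "GDERIV f x :> grad f x" and "frechet_derivative f (at x) v = grad f x \<bullet> v"
proof -
  let ?D = "frechet_derivative f (at x)"
  let ?g = "\<Sum>b\<in>Basis. ?D b *\<^sub>R b"
  have "C_diff (Suc 0) f" using assms unfolding smooth_def by blast
  then have "f differentiable (at x)" by simp
  then have D: "(f has_derivative ?D) (at x)" by (simp add: frechet_derivative_works)
  then have "linear ?D" by (rule has_derivative_linear)
  then have eq: "?D v = v \<bullet> ?g" for v
    using Linear_Algebra.linear_componentwise[of ?D v 1]
    by (simp add: inner_sum_right mult.commute)
  then have "?D = (\<lambda>v. v \<bullet> ?g)" by blast
  with D have "GDERIV f x :> ?g" unfolding gderiv_def by simp
  with grad_eqI[OF this] eq[of v]
  show "GDERIV f x :> grad f x" "frechet_derivative f (at x) v = grad f x \<bullet> v"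
    by (simp_all add: inner_commute)
qed

lemma smooth_continuous: "smooth f \<Longrightarrow> continuous_on A f"
  unfolding smooth_def by (metis C_diff.simps(1) continuous_on_subset subset_UNIV)

lemma smooth_grad_lipschitz:
  fixes f :: "'a::euclidean_space \<Rightarrow> real"
  assumes "smooth f"
  shows "\<exists>K\<ge>0. \<forall>x\<in>cball 0 r. \<forall>y\<in>cball 0 r. norm (grad f x - grad f y) \<le> K * norm (x - y)"
proof -
  have "\<exists>K\<ge>0. \<forall>x\<in>cball 0 r. \<forall>y\<in>cball 0 r. \<bar>grad f x \<bullet> b - grad f y \<bullet> b\<bar> \<le> K * norm (x - y)" for b
  proof -
    have "C_diff (Suc 1) f" using assms unfolding smooth_def by blast
    then have "C_diff 1 (\<lambda>x. grad f x \<bullet> b)"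
      unfolding C_diff.simps(2)[of 1] smooth_grad(2)[OF assms] by blast
    then show ?thesis by (rule C_diff_1_lipschitz)
  qed
  then obtain K where K: "\<And>b. K b \<ge> 0" "\<And>b x y. x \<in> cball 0 r \<Longrightarrow> y \<in> cball 0 r \<Longrightarrow>
      \<bar>grad f x \<bullet> b - grad f y \<bullet> b\<bar> \<le> K b * norm (x - y)"
    by metis
  have "norm (grad f x - grad f y) \<le> (\<Sum>b\<in>Basis. K b) * norm (x - y)"
    if "x \<in> cball 0 r" "y \<in> cball 0 r" for x y
  proof -
    have "norm (grad f x - grad f y) \<le> (\<Sum>b\<in>Basis. \<bar>(grad f x - grad f y) \<bullet> b\<bar>)"
      by (rule norm_le_l1)
    also have "\<dots> \<le> (\<Sum>b\<in>Basis. K b * norm (x - y))"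
      by (intro sum_mono) (use K(2) that in \<open>simp add: inner_diff_left\<close>)
    finally show ?thesis by (simp add: sum_distrib_right)
  qed
  moreover have "(\<Sum>b\<in>Basis. K b) \<ge> 0" by (intro sum_nonneg K)
  ultimately show ?thesis by blast
qed

text \<open>
  The mean value inequality for \<open>f\<close> minus its linear part at \<open>x\<close>, whose derivative on the ball
  around \<open>x\<close> through \<open>y\<close> is bounded by the Lipschitz property of the gradient.
\<close>

lemma smooth_taylor_quadratic:
  fixes f :: "'a::euclidean_space \<Rightarrow> real"
  assumes "smooth f"
  shows "\<exists>K. \<forall>x\<in>cball 0 r. \<forall>y\<in>cball 0 r.
    \<bar>f y - f x - grad f x \<bullet> (y - x)\<bar> \<le> K * (norm (y - x))\<^sup>2"
proof -
  obtain K where K: "K \<ge> 0" "\<And>x y. x \<in> cball 0 r \<Longrightarrow> y \<in> cball 0 r \<Longrightarrow>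
      norm (grad f x - grad f y) \<le> K * norm (x - y)"
    using smooth_grad_lipschitz[OF assms] by metis
  have "\<bar>f y - f x - grad f x \<bullet> (y - x)\<bar> \<le> K * (norm (y - x))\<^sup>2"
    if x: "x \<in> cball 0 r" and y: "y \<in> cball 0 r" for x y
  proof -
    let ?S = "cball 0 r \<inter> cball x (norm (y - x))"
    have "norm ((f y - grad f x \<bullet> y) - (f x - grad f x \<bullet> x)) \<le> K * norm (y - x) * norm (y - x)"
    proof (rule differentiable_bound[of ?S])
      fix z assume z: "z \<in> ?S"
      have "(f has_derivative (\<lambda>h. h \<bullet> grad f z)) (at z within ?S)"
        using smooth_grad(1)[OF assms] unfolding gderiv_def by (rule has_derivative_at_withinI)
      then show "((\<lambda>z. f z - grad f x \<bullet> z) has_derivative (\<lambda>h. h \<bullet> grad f z - grad f x \<bullet> h))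
          (at z within ?S)"
        by (auto intro!: derivative_eq_intros)
      show "onorm (\<lambda>h. h \<bullet> grad f z - grad f x \<bullet> h) \<le> K * norm (y - x)"
      proof (rule onorm_le)
        fix h
        have "norm (h \<bullet> grad f z - grad f x \<bullet> h) = \<bar>(grad f z - grad f x) \<bullet> h\<bar>"
          by (simp add: inner_diff_left inner_diff_right inner_commute)
        also have "\<dots> \<le> norm (grad f z - grad f x) * norm h" by (rule Cauchy_Schwarz_ineq2)
        also have "norm (grad f z - grad f x) \<le> K * norm (z - x)" using K(2) z x by blast
        also have "\<dots> \<le> K * norm (y - x)"
          using z K(1) by (intro mult_left_mono) (auto simp: dist_norm norm_minus_commute)
        finally show "norm (h \<bullet> grad f z - grad f x \<bullet> h) \<le> K * norm (y - x) * norm h"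
          by (simp add: mult_right_mono)
      qed
    qed (use x y in \<open>auto simp: dist_norm norm_minus_commute intro: convex_Int\<close>)
    then show ?thesis by (simp add: inner_diff_right power2_eq_square algebra_simps)
  qed
  then show ?thesis by blast
qed

lemma critical_quadratic:
  fixes f :: "'a::euclidean_space \<Rightarrow> real"
  assumes "smooth f"
  shows "\<exists>L. \<forall>x\<in>{x. grad f x = 0} \<inter> cball 0 r. \<forall>y\<in>{x. grad f x = 0} \<inter> cball 0 r.
    \<bar>f x - f y\<bar> \<le> L * (norm (x - y))\<^sup>2"
proof -
  obtain K where K: "\<And>x y. x \<in> cball 0 r \<Longrightarrow> y \<in> cball 0 r \<Longrightarrow>
      \<bar>f y - f x - grad f x \<bullet> (y - x)\<bar> \<le> K * (norm (y - x))\<^sup>2"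
    using smooth_taylor_quadratic[OF assms] by blast
  show ?thesis
  proof (intro exI[of _ K] ballI)
    fix x y assume "x \<in> {x. grad f x = 0} \<inter> cball 0 r" "y \<in> {x. grad f x = 0} \<inter> cball 0 r"
    then show "\<bar>f x - f y\<bar> \<le> K * (norm (x - y))\<^sup>2" using K[of y x] by simp
  qed
qed

text \<open>
  On the sphere the linear term is itself quadratic: for \<open>grad f y = \<mu> *\<^sub>R y\<close> and \<open>norm x = norm y\<close>,
  \<open>grad f y \<bullet> (x - y) = - \<mu> * (norm (x - y))\<^sup>2 / 2\<close>. The multiplier \<open>\<mu>\<close> is bounded because the
  gradient is bounded on the sphere.
\<close>

lemma sphere_critical_quadratic:
  fixes f :: "'a::euclidean_space \<Rightarrow> real"
  assumes "smooth f" "R > 0"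
  shows "\<exists>L. \<forall>x\<in>M_set f \<inter> sphere 0 R. \<forall>y\<in>M_set f \<inter> sphere 0 R.
    \<bar>f x - f y\<bar> \<le> L * (norm (x - y))\<^sup>2"
proof -
  obtain K where K: "\<And>x y. x \<in> cball 0 R \<Longrightarrow> y \<in> cball 0 R \<Longrightarrow>
      \<bar>f y - f x - grad f x \<bullet> (y - x)\<bar> \<le> K * (norm (y - x))\<^sup>2"
    using smooth_taylor_quadratic[OF assms(1)] by blast
  obtain K' where K': "K' \<ge> 0" "\<And>x y. x \<in> cball 0 R \<Longrightarrow> y \<in> cball 0 R \<Longrightarrow>
      norm (grad f x - grad f y) \<le> K' * norm (x - y)"
    using smooth_grad_lipschitz[OF assms(1)] by metis
  define B where "B = norm (grad f 0) + K' * R"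
  show ?thesis
  proof (intro exI[of _ "K + B / (2 * R)"] ballI)
    fix x y assume "x \<in> M_set f \<inter> sphere 0 R" "y \<in> M_set f \<inter> sphere 0 R"
    then obtain \<mu> where \<mu>: "grad f y = \<mu> *\<^sub>R y" and norms: "norm x = R" "norm y = R"
      unfolding M_set_def by auto
    have "norm (grad f y - grad f 0) \<le> K' * R" using K'(2)[of y 0] norms assms(2) by simp
    then have "norm (grad f y) \<le> B"
      unfolding B_def using norm_triangle_ineq2[of "grad f y" "grad f 0"] by simp
    then have mu: "\<bar>\<mu>\<bar> \<le> B / R" using norms assms(2) unfolding \<mu> by (simp add: field_simps)
    have "y \<bullet> (x - y) = - (norm (x - y))\<^sup>2 / 2"
      using dot_norm_neg[of x y] norms
      by (simp add: inner_diff_right inner_commute dot_square_norm field_simps)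
    then have "\<bar>grad f y \<bullet> (x - y)\<bar> = \<bar>\<mu>\<bar> * ((norm (x - y))\<^sup>2 / 2)"
      unfolding \<mu> by (simp add: abs_mult)
    also have "\<dots> \<le> B / R * ((norm (x - y))\<^sup>2 / 2)" by (intro mult_right_mono mu) simp
    finally have "\<bar>grad f y \<bullet> (x - y)\<bar> \<le> B / (2 * R) * (norm (x - y))\<^sup>2" by simp
    moreover have "\<bar>f x - f y - grad f y \<bullet> (x - y)\<bar> \<le> K * (norm (x - y))\<^sup>2"
      using K[of y x] norms by simp
    ultimately show "\<bar>f x - f y\<bar> \<le> (K + B / (2 * R)) * (norm (x - y))\<^sup>2"
      unfolding distrib_right by linarith
  qed
qed

text \<open>
  A first-order description of the partial derivatives, from which their definability can be read
  off.
\<close>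

lemma grad_component_iff:
  fixes f :: "real ^ 'n \<Rightarrow> real"
  assumes "smooth f"
  shows "d = grad f x $ i \<longleftrightarrow> (\<forall>\<epsilon>>0. \<exists>\<delta>>0. \<forall>h. \<bar>h\<bar> < \<delta> \<longrightarrow>
    \<bar>f (\<chi> j. x $ j + (if j = i then h else 0)) - f x - d * h\<bar> \<le> \<epsilon> * \<bar>h\<bar>)" (is "_ \<longleftrightarrow> ?R")
proof -
  let ?\<phi> = "\<lambda>h::real. f (x + h *\<^sub>R axis i 1)"
  have vec: "(\<chi> j. x $ j + (if j = i then h else 0)) = x + h *\<^sub>R axis i 1" for h
    by (simp add: vec_eq_iff axis_def)
  have "(f has_derivative (\<lambda>h. h \<bullet> grad f x)) (at (x + 0 *\<^sub>R axis i 1))"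
    using smooth_grad(1)[OF assms, of x] unfolding gderiv_def by simp
  moreover have "((\<lambda>h. x + h *\<^sub>R axis i 1) has_derivative (\<lambda>h. h *\<^sub>R axis i 1)) (at (0::real))"
    by (auto intro!: derivative_eq_intros)
  ultimately have "(?\<phi> has_derivative (\<lambda>h. (h *\<^sub>R axis i 1) \<bullet> grad f x)) (at 0)"
    by (rule has_derivative_compose[rotated])
  then have D: "(?\<phi> has_derivative (\<lambda>h. grad f x $ i * h)) (at 0)"
    by (simp add: inner_axis' mult.commute)
  have "?R \<longleftrightarrow> (?\<phi> has_derivative (\<lambda>h. d * h)) (at 0)"
    unfolding has_derivative_at_alt vec by (simp add: bounded_linear_mult_right)
  also have "\<dots> \<longleftrightarrow> d = grad f x $ i"
  proof
    assume "(?\<phi> has_derivative (\<lambda>h. d * h)) (at 0)"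
    from has_derivative_unique[OF this D] show "d = grad f x $ i" by (metis mult.right_neutral)
  qed (use D in simp)
  finally show ?thesis by blast
qed

section \<open>Values on connected components\<close>

lemma finite_image_constant_on_connected:
  fixes f :: "'a::topological_space \<Rightarrow> real"
  assumes "continuous_on K f" "connected K" "finite (f ` K)" "x \<in> K" "y \<in> K"
  shows "f x = f y"
  using connected_finite_iff_sing[of "f ` K"] connected_continuous_image[OF assms(1,2)] assms(3-5)
  by (metis empty_iff imageI singletonD)

text \<open>
  Points of \<open>C\<close> with different values lie in different components, since a function with finitely many
  values is constant on each of them.
\<close>

lemma lepoll_components:
  fixes f :: "'a::topological_space \<Rightarrow> real"
  assumes cont: "continuous_on C f" and fin: "finite (f ` C)"
    and sel: "\<And>v. v \<in> S \<Longrightarrow> g v \<in> C"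
    and inj: "\<And>v w. v \<in> S \<Longrightarrow> w \<in> S \<Longrightarrow> f (g v) = f (g w) \<Longrightarrow> v = w"
  shows "S \<lesssim> components C"
  unfolding lepoll_def
proof (intro exI conjI)
  let ?h = "\<lambda>v. connected_component_set C (g v)"
  show "?h ` S \<subseteq> components C" using sel by (auto simp: components_def)
  show "inj_on ?h S"
  proof (rule inj_onI)
    fix v w assume vw: "v \<in> S" "w \<in> S" "?h v = ?h w"
    have sub: "?h v \<subseteq> C" by (rule connected_component_subset)
    have "g v \<in> ?h v" "g w \<in> ?h v"
      using sel vw connected_component_refl by (metis mem_Collect_eq)+
    then have "f (g v) = f (g w)"
      by (rule finite_image_constant_on_connected[rotated 3])
        (use sub cont fin in \<open>auto intro: continuous_on_subset finite_subset[OF image_mono]\<close>)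
    with inj vw show "v = w" by blast
  qed
qed

section \<open>Critical values and asymptotic critical values\<close>

context o_minimal_structure
begin

text \<open>
  An infinite set of limits would contain an interval. For each \<open>v\<close> in it, \<open>W R v\<close> is
  eventually true or eventually false as \<open>R\<close> grows, and both the truth value \<open>m\<close> and the threshold
  can be made uniform on a subinterval. If \<open>m\<close> holds, one fibre contains the subinterval; otherwise no
  value near its midpoint is ever taken for large \<open>R\<close>, and the midpoint is not a limit.
\<close>

lemma finite_asymptotic_values:
  fixes W :: "real \<Rightarrow> real \<Rightarrow> bool"
  assumes W: "\<And>i j. definable_pred (\<lambda>\<rho>. W (\<rho> i) (\<rho> j))"
    and fin: "\<And>R. R > 0 \<Longrightarrow> finite {v. W R v}"
  shows "finite {c. \<forall>\<epsilon>>0. \<forall>N. \<exists>R\<ge>N. \<exists>v. W R v \<and> \<bar>v - c\<bar> < \<epsilon>}" (is "finite ?S")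
proof (rule ccontr)
  assume inf: "infinite ?S"
  have "definable_pred (\<lambda>\<rho>. \<rho> 0 \<in> ?S)"
    unfolding mem_Collect_eq
    by (intro definable_all definable_ex definable_imp definable_conj W definable_less definable_le
        definable_abs definable_diff definable_var definable_const)
  from definable_infinite_contains_open[OF this, of UNIV] inf
  obtain a b where ab: "a < b" "{a<..<b} \<subseteq> ?S" by auto
  define T where "T = (\<lambda>(m::bool, N::nat). {v. \<forall>R\<ge>real (Suc N). W R v \<longleftrightarrow> m})"
  have "definable_pred (\<lambda>\<rho>. \<forall>R\<ge>real (Suc N). W R (\<rho> 0) \<longleftrightarrow> m)" for m N
    by (cases m) (simp_all add: definable_all definable_imp definable_le definable_not W
        definable_var definable_const del: of_nat_Suc)
  then have def_T: "definable_pred (\<lambda>\<rho>. \<rho> 0 \<in> T p)" for p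
    unfolding T_def split_beta mem_Collect_eq by simp
  have cover: "{a<..<b} \<subseteq> (\<Union>p. T p)"
  proof
    fix v :: real
    have "definable_pred (\<lambda>\<rho>. \<rho> 0 \<in> {R. \<exists>u. u = v \<and> W R u})"
      unfolding mem_Collect_eq
      by (intro definable_ex definable_conj definable_eq W definable_var definable_const)
    then have "(\<forall>\<^sub>F R in at_top. W R v) \<or> (\<forall>\<^sub>F R in at_top. \<not> W R v)"
      using definable_eventually[of "{R. \<exists>u. u = v \<and> W R u}" at_top] by simp
    then obtain m R0 where R0: "\<And>R. R \<ge> R0 \<Longrightarrow> W R v \<longleftrightarrow> m"
      unfolding eventually_at_top_linorder by blast
    obtain N where "R0 \<le> real N" using real_arch_simple by blast
    then have "v \<in> T (m, N)" unfolding T_def using R0 by auto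
    then show "v \<in> (\<Union>p. T p)" by blast
  qed
  obtain p c d where cd: "a \<le> c" "c < d" "d \<le> b" "{c<..<d} \<subseteq> T p"
    by (rule definable_countable_cover[OF def_T ab(1) cover])
  obtain m N where p: "p = (m, N)" by (cases p)
  have T: "W R v \<longleftrightarrow> m" if "c < v" "v < d" "R \<ge> real (Suc N)" for R v
  proof -
    have "v \<in> T (m, N)" using cd(4) that p by auto
    then show ?thesis using that(3) unfolding T_def by simp
  qed
  show False
  proof (cases m)
    case True
    then have "{c<..<d} \<subseteq> {v. W (real (Suc N)) v}" using T by auto
    then have "finite {c<..<d}" using fin[of "real (Suc N)"] finite_subset by auto
    then show False using cd(2) by (simp add: infinite_Ioo)
  next
    case False
    let ?v = "(c + d) / 2"
    have v: "a < ?v" "?v < b" using cd by auto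
    have "?v \<in> {a<..<b}" using v by (simp only: greaterThanLessThan_iff)
    with ab(2) have "?v \<in> ?S" by (rule subsetD)
    moreover have "(d - c) / 2 > 0" using cd(2) by simp
    ultimately obtain R v where "R \<ge> real (Suc N)" "W R v" "\<bar>v - ?v\<bar> < (d - c) / 2" by blast
    moreover from this have "c < v" "v < d" by (auto simp: abs_less_iff field_simps)
    ultimately show False using T False by blast
  qed
qed

end

context definable_function
begin

lemma definable_grad:
  assumes "smooth f"
  shows "definable_term (\<lambda>\<rho>. grad f (\<chi> j. \<rho> (ix j)) $ i)"
  unfolding definable_term_def grad_component_iff[OF assms]
  by (intro definable_all definable_ex definable_imp definable_conj definable_less definable_le
      definable_abs definable_diff definable_add definable_mult definable_apply definable_component
      definable_if definable_var definable_const)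

lemma definable_critical_set:
  assumes "smooth f"
  shows "definable_pred (\<lambda>\<rho>. (\<chi> j. \<rho> (ix j)) \<in> {x. grad f x = 0})"
proof -
  have eq: "grad f x = 0 \<longleftrightarrow> (\<forall>i\<in>UNIV. grad f x $ i = 0)" for x by (simp add: vec_eq_iff)
  show ?thesis unfolding mem_Collect_eq eq
    by (intro definable_finite_all definable_eq definable_grad assms definable_const finite)
qed

lemma definable_M_set:
  assumes "smooth f"
  shows "definable_pred (\<lambda>\<rho>. (\<chi> j. \<rho> (ix j)) \<in> M_set f)"
proof -
  have eq: "x \<in> M_set f \<longleftrightarrow> (\<exists>\<mu>. \<forall>i\<in>UNIV. grad f x $ i = \<mu> * x $ i)" for x
    by (simp add: M_set_def vec_eq_iff)
  show ?thesis unfolding eq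
    by (intro definable_ex definable_finite_all definable_eq definable_grad assms definable_mult
        definable_component definable_var finite)
qed

lemma norm_eq_iff: "R > 0 \<Longrightarrow> norm x = R \<longleftrightarrow> (\<Sum>i\<in>UNIV. x $ i * x $ i) = R * R" for x :: "real ^ 'n"
proof -
  assume "R > 0"
  then have "norm x = R \<longleftrightarrow> (norm x)\<^sup>2 = R\<^sup>2" by (simp add: power2_eq_iff_nonneg)
  then show ?thesis
    unfolding power2_norm_eq_inner by (simp add: inner_vec_def power2_eq_square)
qed

lemma finite_critical_values:
  assumes "smooth f"
  shows "finite (f ` {x. grad f x = 0})"
  by (rule finite_image_if_quadratically_flat[OF definable_critical_set[OF assms] critical_quadratic[OF assms]])

lemma finite_sphere_critical_values:
  assumes "smooth f" "R > 0"
  shows "finite (f ` (M_set f \<inter> sphere 0 R))"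
proof (rule finite_image_if_quadratically_flat)
  fix ix :: "'n \<Rightarrow> nat"
  show "definable_pred (\<lambda>\<rho>. (\<chi> j. \<rho> (ix j)) \<in> M_set f \<inter> sphere 0 R)"
    unfolding Int_iff mem_sphere_0 norm_eq_iff[OF assms(2)]
    by (intro definable_conj definable_M_set assms definable_eq definable_sum definable_mult
        definable_component definable_var definable_const finite)
next
  fix r
  show "\<exists>L. \<forall>x\<in>M_set f \<inter> sphere 0 R \<inter> cball 0 r. \<forall>y\<in>M_set f \<inter> sphere 0 R \<inter> cball 0 r.
      \<bar>f x - f y\<bar> \<le> L * (norm (x - y))\<^sup>2"
    using sphere_critical_quadratic[OF assms] by blast
qed

text \<open>
  For \<open>R > 0\<close> the sphere is given by a polynomial equation that involves only \<open>R\<^sup>2\<close>; for negative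
  radii that equation would describe a sphere as well.
\<close>

definition sphere_value :: "real \<Rightarrow> real \<Rightarrow> bool" where
  "sphere_value R v \<longleftrightarrow> R > 0 \<and> v \<in> f ` (M_set f \<inter> sphere 0 R)"

lemma definable_sphere_value:
  assumes "smooth f"
  shows "definable_pred (\<lambda>\<rho>. sphere_value (\<rho> i) (\<rho> j))"
proof -
  have eq: "sphere_value R v \<longleftrightarrow> 0 < R \<and>
      (\<exists>x. x \<in> M_set f \<and> (\<Sum>i\<in>UNIV. x $ i * x $ i) = R * R \<and> v = f (\<chi> j. x $ j))" for R v
    unfolding sphere_value_def using norm_eq_iff[of R] by auto
  show ?thesis unfolding eq
    by (intro definable_ex_vec definable_conj definable_M_set assms definable_less definable_eq
        definable_sum definable_mult definable_apply definable_component definable_var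
        definable_const finite)
qed

text \<open>
  The sequences in the definition of \<open>S_set\<close> are eliminated, which leaves a first-order condition on
  the values taken on spheres.
\<close>

lemma S_set_iff:
  "c \<in> S_set f \<longleftrightarrow> (\<forall>\<epsilon>>0. \<forall>N. \<exists>R\<ge>N. \<exists>v. sphere_value R v \<and> \<bar>v - c\<bar> < \<epsilon>)"
proof
  assume "c \<in> S_set f"
  then obtain y where y: "\<And>k. y k \<in> M_set f" "filterlim (\<lambda>k. norm (y k)) at_top sequentially"
    "(\<lambda>k. f (y k)) \<longlonglongrightarrow> c" unfolding S_set_def by blast
  show "\<forall>\<epsilon>>0. \<forall>N. \<exists>R\<ge>N. \<exists>v. sphere_value R v \<and> \<bar>v - c\<bar> < \<epsilon>"
  proof (intro allI impI)
    fix \<epsilon> N :: real assume "\<epsilon> > 0"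
    have "\<forall>\<^sub>F k in sequentially. norm (y k) \<ge> max N 1"
      using y(2) unfolding filterlim_at_top by blast
    moreover have "\<forall>\<^sub>F k in sequentially. dist (f (y k)) c < \<epsilon>"
      using y(3) \<open>\<epsilon> > 0\<close> by (rule tendstoD)
    ultimately have "\<forall>\<^sub>F k in sequentially. norm (y k) \<ge> max N 1 \<and> dist (f (y k)) c < \<epsilon>"
      by (rule eventually_conj)
    then obtain k where "norm (y k) \<ge> max N 1" "dist (f (y k)) c < \<epsilon>"
      using eventually_happens'[OF sequentially_bot] by blast
    then show "\<exists>R\<ge>N. \<exists>v. sphere_value R v \<and> \<bar>v - c\<bar> < \<epsilon>"
      using y(1)[of k]
      by (intro exI[of _ "norm (y k)"] conjI exI[of _ "f (y k)"])
        (auto simp: sphere_value_def dist_real_def)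
  qed
next
  assume R: "\<forall>\<epsilon>>0. \<forall>N. \<exists>R\<ge>N. \<exists>v. sphere_value R v \<and> \<bar>v - c\<bar> < \<epsilon>"
  have "\<exists>x. x \<in> M_set f \<and> norm x \<ge> real k \<and> \<bar>f x - c\<bar> < inverse (real (Suc k))" for k
  proof -
    obtain r v where "r \<ge> real k" "sphere_value r v" "\<bar>v - c\<bar> < inverse (real (Suc k))"
      using R by (metis inverse_positive_iff_positive of_nat_0_less_iff zero_less_Suc)
    then show ?thesis unfolding sphere_value_def by auto
  qed
  then obtain y where y: "\<And>k. y k \<in> M_set f" "\<And>k. norm (y k) \<ge> real k"
    "\<And>k. \<bar>f (y k) - c\<bar> < inverse (real (Suc k))" by metis
  have "filterlim (\<lambda>k. norm (y k)) at_top sequentially"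
    by (rule filterlim_at_top_mono[OF filterlim_real_sequentially]) (simp add: y)
  moreover have "(\<lambda>k. f (y k)) \<longlonglongrightarrow> c"
    by (rule metric_tendsto_imp_tendsto[OF LIMSEQ_inverse_real_of_nat])
      (use y(3) in \<open>auto simp: dist_real_def intro!: always_eventually less_imp_le\<close>)
  ultimately show "c \<in> S_set f" unfolding S_set_def using y(1) by blast
qed

lemma finite_S_set:
  assumes "smooth f"
  shows "finite (S_set f)"
proof -
  have "finite {v. sphere_value R v}" if "R > 0" for R
    using finite_sphere_critical_values[OF assms that] that by (simp add: sphere_value_def)
  from finite_asymptotic_values[of sphere_value, OF definable_sphere_value[OF assms] this] show ?thesis
    unfolding S_set_iff[symmetric] Collect_mem_eq .
qed

text \<open>
  The radii in question form a definable set. It is unbounded by \<open>S_set_iff\<close>, hence contains all large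
  radii.
\<close>

lemma eventually_near_value:
  assumes "smooth f" "c \<in> S_set f" "\<epsilon> > 0"
  shows "\<forall>\<^sub>F R in at_top. \<exists>v. sphere_value R v \<and> \<bar>v - c\<bar> < \<epsilon>"
proof -
  let ?A = "{R. \<exists>v. sphere_value R v \<and> \<bar>v - c\<bar> < \<epsilon>}"
  have "definable_pred (\<lambda>\<rho>. \<rho> 0 \<in> ?A)"
    unfolding mem_Collect_eq
    by (intro definable_ex definable_conj definable_sphere_value assms definable_less definable_abs
        definable_diff definable_var definable_const)
  then have "(\<forall>\<^sub>F R in at_top. R \<in> ?A) \<or> (\<forall>\<^sub>F R in at_top. R \<notin> ?A)"
    by (rule definable_eventually) simp
  moreover have "\<not> (\<forall>\<^sub>F R in at_top. R \<notin> ?A)"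
    using assms(2,3) unfolding S_set_iff eventually_at_top_linorder by blast
  ultimately show ?thesis by simp
qed

lemma crit_values_lepoll:
  assumes "smooth f"
  shows "crit_values f \<lesssim> components {x. grad f x = 0}"
proof -
  have "\<exists>x. grad f x = 0 \<and> f x = v" if "v \<in> crit_values f" for v
    using that unfolding crit_values_def by blast
  then obtain g where "\<And>v. v \<in> crit_values f \<Longrightarrow> grad f (g v) = 0 \<and> f (g v) = v" by metis
  then show ?thesis
    by (intro lepoll_components[OF smooth_continuous[OF assms] finite_critical_values[OF assms], of _ g])
      auto
qed

lemma S_set_lepoll:
  assumes "smooth f"
  shows "\<forall>\<^sub>F R in at_top. S_set f \<lesssim> components (M_set f \<inter> sphere 0 R)"
proof -
  obtain \<delta> where \<delta>: "\<delta> > 0"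
    "\<And>c c'. c \<in> S_set f \<Longrightarrow> c' \<in> S_set f \<Longrightarrow> c \<noteq> c' \<Longrightarrow> \<delta> \<le> dist c c'"
    using finite_S_set[OF assms]
    unfolding uniform_discrete_finite_iff[symmetric] uniform_discrete_def by (metis not_le)
  have "\<forall>\<^sub>F R in at_top. \<forall>c\<in>S_set f. \<exists>v. sphere_value R v \<and> \<bar>v - c\<bar> < \<delta> / 2"
    using \<delta>(1) by (intro eventually_ball_finite finite_S_set assms ballI eventually_near_value) auto
  then show ?thesis
    using eventually_gt_at_top[of 0]
  proof eventually_elim
    case (elim R)
    then have "\<exists>x. x \<in> M_set f \<inter> sphere 0 R \<and> \<bar>f x - c\<bar> < \<delta> / 2" if "c \<in> S_set f" for c
      using that unfolding sphere_value_def by blast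
    then obtain g where g: "\<And>c. c \<in> S_set f \<Longrightarrow> g c \<in> M_set f \<inter> sphere 0 R"
      "\<And>c. c \<in> S_set f \<Longrightarrow> \<bar>f (g c) - c\<bar> < \<delta> / 2" by metis
    have "c = c'" if "c \<in> S_set f" "c' \<in> S_set f" "f (g c) = f (g c')" for c c'
    proof (rule ccontr)
      assume "c \<noteq> c'"
      then have "\<delta> \<le> \<bar>c - c'\<bar>" using \<delta>(2) that by (simp add: dist_real_def)
      with g(2)[OF that(1)] g(2)[OF that(2)] that(3) show False by linarith
    qed
    with g(1) show ?case
      by (intro lepoll_components[OF smooth_continuous[OF assms]
            finite_sphere_critical_values[OF assms \<open>0 < R\<close>], of _ g])
  qed
qed

end

theorem proposition1p6:
  fixes D :: "nat \<Rightarrow> real list set set"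
    and e :: "nat \<Rightarrow> 'n::finite"
    and f :: "real ^ 'n \<Rightarrow> real"
  assumes "o_minimal_structure D"
    and "bij_betw e {..<CARD('n)} UNIV"
    and "smooth f"
    and "definable_fun D e f"
  shows "crit_values f \<lesssim> components {x. grad f x = 0} \<and>
    (\<exists>R\<^sub>0>0. \<forall>R\<ge>R\<^sub>0. S_set f \<lesssim> components (M_set f \<inter> sphere 0 R))"
proof -
  interpret definable_function D e f
    using assms by (simp add: definable_function_def definable_function_axioms_def)
  obtain R1 where R1: "\<And>R. R \<ge> R1 \<Longrightarrow> S_set f \<lesssim> components (M_set f \<inter> sphere 0 R)"
    using S_set_lepoll[OF assms(3)] unfolding eventually_at_top_linorder by blast
  then have "\<exists>R\<^sub>0>0. \<forall>R\<ge>R\<^sub>0. S_set f \<lesssim> components (M_set f \<inter> sphere 0 R)"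
    by (intro exI[of _ "max R1 1"]) auto
  with crit_values_lepoll[OF assms(3)] show ?thesis by blast
qed

end
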